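(* Let $(\mathbf{u},\mathbf{B})$ be a smooth axisymmetric self-similar solution in $\mathbb{R}^3\setminus\{0\}$ to the stationary incompressible MHD equations without magnetic diffusion $$ \begin{cases} -\Delta \mathbf{u}+(\mathbf{u}\cdot\nabla)\mathbf{u}-(\mathbf{B}\cdot\nabla)\mathbf{B}+\nabla p=0,\\ (\mathbf{u}\cdot\nabla)\mathbf{B}=(\mathbf{B}\cdot\nabla)\mathbf{u},\\ \operatorname{div}\mathbf{u}=\operatorname{div}\mathbf{B}=0. \end{cases} $$ Assume that $\mathbf{B}=\frac{B(\varphi)}{\rho}\,\mathbf{e}_\theta$ for some scalar function $B$ of $\varphi$, where $(\rho,\theta,\varphi)$ are spherical coordinates. Then $\mathbf{u}$ is a Landau solution and $\mathbf{B}=0$.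
   Context: **Spherical coordinates.** $(x_1,x_2,x_3)=(\rho\sin\varphi\cos\theta,\ \rho\sin\varphi\sin\theta,\ \rho\cos\varphi)$, with orthonormal basis vectors $\mathbf{e}_\rho=x/\rho$, $\mathbf{e}_\theta=(-\sin\theta,\cos\theta,0)$, $\mathbf{e}_\varphi=\mathbf{e}_\theta\times\mathbf{e}_\rho=(\cos\varphi\cos\theta,\cos\varphi\sin\theta,-\sin\varphi)$. **Axisymmetric.** A vector field $\mathbf{v}$ is axisymmetric if it has the form $\mathbf{v}=v^\rho(\rho,\varphi)\mathbf{e}_\rho+v^\theta(\rho,\varphi)\mathbf{e}_\theta+v^\varphi(\rho,\varphi)\mathbf{e}_\varphi$ (components independent of $\theta$; a nonzero swirl component $v^\theta$ is allowed). The solution $(\mathbf{u},\mathbf{B})$ is axisymmetric if both $\mathbf{u}$ and $\mathbf{B}$ are. **Solution, self-similar.** Here $\mathbf{u}$ (velocity) and $\mathbf{B}$ (magnetic field) are vector fields with values in $\mathbb{R}^3$, and $p$ (pressure) is the associated real-valued scalar function. The solution is self-similar if, for every $\lambda>0$ and all $x$ in the domain, $\mathbf{u}(x)=\lambda\mathbf{u}(\lambda x)$, $\mathbf{B}(x)=\lambda\mathbf{B}(\lambda x)$ and $p(x)=\lambda^2p(\lambda x)$. **Landau solutions.** For each $b\in\mathbb{R}^3$ there is a unique $(-1)$-homogeneous vector field $\mathbf{U}^b$, with an associated $(-2)$-homogeneous pressure $P^b$, such that $\mathbf{U}^b,P^b$ are smooth in $\mathbb{R}^3\setminus\{0\}$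 and $$-\Delta\mathbf{U}^b+\operatorname{div}(\mathbf{U}^b\otimes\mathbf{U}^b)+\nabla P^b=b\,\delta,\qquad \operatorname{div}\mathbf{U}^b=0$$ in the sense of distributions in $\mathbb{R}^3$, where $\delta$ is the Dirac function at the origin. The fields $\mathbf{U}^b$, $b\in\mathbb{R}^3$, are called the Landau solutions. For $b=0$, $\mathbf{U}^0=0$. For $b=(0,0,\beta)$ with $\beta\neq0$ they are given explicitly by $$\mathbf{U}^b=\frac{2}{\rho}\left[\left(\frac{a^2-1}{(a-\cos\varphi)^2}-1\right)\mathbf{e}_\rho+\frac{-\sin\varphi}{a-\cos\varphi}\,\mathbf{e}_\varphi\right],\qquad P^b=\frac{4(a\cos\varphi-1)}{\rho^2(a-\cos\varphi)^2},$$ where $a\in\mathbb{R}$, $|a|>1$, is related to $\beta$ by $\beta=16\pi\left[a+\frac12a^2\log\left(\frac{a-1}{a+1}\right)+\frac{4a}{3(a^2-1)}\right]$. The Landau solution for general $b$ is obtained by rotation. *)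

theory Defs
  imports "HOL-Analysis.Analysis"
begin

section \<open>Differential operators on Euclidean three-space\<close>

definition pd :: "3 \<Rightarrow> (real^3 \<Rightarrow> 'b::real_normed_vector) \<Rightarrow> real^3 \<Rightarrow> 'b" where
  "pd i f x = frechet_derivative f (at x) (axis i 1)"

definition laplacian :: "(real^3 \<Rightarrow> 'b::real_normed_vector) \<Rightarrow> real^3 \<Rightarrow> 'b" where
  "laplacian f x = (\<Sum>i\<in>UNIV. pd i (pd i f) x)"

definition gradient :: "(real^3 \<Rightarrow> real) \<Rightarrow> real^3 \<Rightarrow> real^3" where
  "gradient f x = (\<chi> i. pd i f x)"

definition divergence :: "(real^3 \<Rightarrow> real^3) \<Rightarrow> real^3 \<Rightarrow> real" where
  "divergence v x = (\<Sum>i\<in>UNIV. pd i v x $ i)"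

text \<open>\<open>advection v w\<close> is \<open>(v \<cdot> \<nabla>) w\<close>.\<close>

definition advection :: "(real^3 \<Rightarrow> real^3) \<Rightarrow> (real^3 \<Rightarrow> real^3) \<Rightarrow> real^3 \<Rightarrow> real^3" where
  "advection v w x = (\<Sum>j\<in>UNIV. (v x $ j) *\<^sub>R pd j w x)"

text \<open>Intended for open \<open>S\<close> only: the derivatives are two-sided, so the values of \<open>f\<close> outside
  an open \<open>S\<close> are irrelevant.\<close>

fun Ck_on :: "nat \<Rightarrow> (real^3 \<Rightarrow> 'b::real_normed_vector) \<Rightarrow> (real^3) set \<Rightarrow> bool" where
  "Ck_on 0 f S \<longleftrightarrow> continuous_on S f"
| "Ck_on (Suc k) f S \<longleftrightarrow> (\<forall>x\<in>S. f differentiable (at x)) \<and> (\<forall>i. Ck_on k (pd i f) S)"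

definition smooth_on :: "(real^3 \<Rightarrow> 'b::real_normed_vector) \<Rightarrow> (real^3) set \<Rightarrow> bool" where
  "smooth_on f S \<longleftrightarrow> (\<forall>k. Ck_on k f S)"


section \<open>Spherical coordinates, axial symmetry and homogeneity\<close>

definition spherical :: "real \<Rightarrow> real \<Rightarrow> real \<Rightarrow> real^3" where
  "spherical \<rho> \<theta> \<phi> = vector [\<rho> * sin \<phi> * cos \<theta>, \<rho> * sin \<phi> * sin \<theta>, \<rho> * cos \<phi>]"

definition e_rho :: "real \<Rightarrow> real \<Rightarrow> real^3" where
  "e_rho \<theta> \<phi> = vector [sin \<phi> * cos \<theta>, sin \<phi> * sin \<theta>, cos \<phi>]"

definition e_theta :: "real \<Rightarrow> real^3" where
  "e_theta \<theta> = vector [- sin \<theta>, cos \<theta>, 0]"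

definition e_phi :: "real \<Rightarrow> real \<Rightarrow> real^3" where
  "e_phi \<theta> \<phi> = vector [cos \<phi> * cos \<theta>, cos \<phi> * sin \<theta>, - sin \<phi>]"

text \<open>Here \<open>\<phi>\<close> is the polar angle.  The points of the axis (\<open>sin \<phi> = 0\<close>) are left out
  because the frame is not determined by the point there.\<close>

definition axisymmetric :: "(real^3 \<Rightarrow> real^3) \<Rightarrow> bool" where
  "axisymmetric v \<longleftrightarrow>
    (\<exists>v_rho v_theta v_phi :: real \<Rightarrow> real \<Rightarrow> real.
      \<forall>\<rho> \<theta> \<phi>. 0 < \<rho> \<longrightarrow> 0 < \<phi> \<longrightarrow> \<phi> < pi \<longrightarrow>
        v (spherical \<rho> \<theta> \<phi>) =
          v_rho \<rho> \<phi> *\<^sub>R e_rho \<theta> \<phi> + v_theta \<rho> \<phi> *\<^sub>R e_theta \<theta> + v_phi \<rho> \<phi> *\<^sub>R e_phi \<theta> \<phi>)"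

definition self_similar ::
  "(real^3 \<Rightarrow> real^3) \<Rightarrow> (real^3 \<Rightarrow> real^3) \<Rightarrow> (real^3 \<Rightarrow> real) \<Rightarrow> bool" where
  "self_similar u B p \<longleftrightarrow>
    (\<forall>c>0. \<forall>x. x \<noteq> 0 \<longrightarrow>
      u x = c *\<^sub>R u (c *\<^sub>R x) \<and> B x = c *\<^sub>R B (c *\<^sub>R x) \<and> p x = c\<^sup>2 * p (c *\<^sub>R x))"

definition homogeneous :: "int \<Rightarrow> (real^3 \<Rightarrow> 'b::real_normed_vector) \<Rightarrow> bool" where
  "homogeneous k f \<longleftrightarrow> (\<forall>c>0. \<forall>x. x \<noteq> 0 \<longrightarrow> f (c *\<^sub>R x) = (c powi k) *\<^sub>R f x)"


section \<open>Landau solutions\<close>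

definition test_function :: "(real^3 \<Rightarrow> real) \<Rightarrow> bool" where
  "test_function \<psi> \<longleftrightarrow> smooth_on \<psi> UNIV \<and> compact (closure {x. \<psi> x \<noteq> 0})"

text \<open>The distributional equations on the whole space, the first one componentwise:
  \<open>-\<Delta>U + div (U \<otimes> U) + \<nabla>P = b \<delta>\<close> and \<open>div U = 0\<close>.
  \<open>has_bochner_integral\<close> includes integrability of the integrand, and the values of
  \<open>U\<close> and \<open>P\<close> at the origin do not matter.\<close>

definition weak_navier_stokes_point_force ::
  "real^3 \<Rightarrow> (real^3 \<Rightarrow> real^3) \<Rightarrow> (real^3 \<Rightarrow> real) \<Rightarrow> bool" where
  "weak_navier_stokes_point_force b U P \<longleftrightarrow>
    (\<forall>\<psi>. test_function \<psi> \<longrightarrow>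
      (\<forall>i. has_bochner_integral lborel
        (\<lambda>x. - (U x $ i) * laplacian \<psi> x
             - (\<Sum>j\<in>UNIV. U x $ i * U x $ j * pd j \<psi> x)
             - P x * pd i \<psi> x)
        (b $ i * \<psi> 0)) \<and>
      has_bochner_integral lborel (\<lambda>x. \<Sum>j\<in>UNIV. U x $ j * pd j \<psi> x) 0)"

definition landau_pair :: "real^3 \<Rightarrow> (real^3 \<Rightarrow> real^3) \<Rightarrow> (real^3 \<Rightarrow> real) \<Rightarrow> bool" where
  "landau_pair b U P \<longleftrightarrow>
    homogeneous (- 1) U \<and> homogeneous (- 2) P \<and>
    smooth_on U (- {0}) \<and> smooth_on P (- {0}) \<and>
    weak_navier_stokes_point_force b U P"

text \<open>For each \<open>b\<close> the field \<open>U\<close> of a \<open>landau_pair\<close> exists and is unique away from the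
  origin; these fields are the Landau solutions.\<close>

definition landau_solution :: "(real^3 \<Rightarrow> real^3) \<Rightarrow> bool" where
  "landau_solution U \<longleftrightarrow> (\<exists>b P. landau_pair b U P)"

end

theory Submission
  imports Defs
begin

text \<open>
  A field that is axisymmetric and homogeneous of degree \<open>-1\<close> is determined by its values on the
  vertical line \<open>(1, 0, z)\<close>.  On that line the rotational derivative and Euler's identity express
  every partial derivative through \<open>d/dz\<close>, so the equations become ordinary differential equations
  in \<open>z\<close>.  Write \<open>u = (a, w, g)\<close> and \<open>B = (0, \<beta>, 0)\<close> on the line and put \<open>V = g - z a\<close>, the Stokes
  stream function at distance \<open>1\<close> from the axis.  Incompressibility is \<open>V' = -a\<close>, and the induction
  equation becomes \<open>V \<beta>' = 2 a \<beta>\<close>.  Hence \<open>V\<^sup>2 \<beta>\<close> is constant.  Since homogeneous fields of degree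
  \<open>-1\<close> are \<open>O(1 / \<bar>z\<bar>)\<close> on the line, \<open>V\<close> is bounded and \<open>\<beta>\<close> tends to \<open>0\<close>, so the constant is \<open>0\<close>
  (\<open>flux_zero\<close>): wherever \<open>\<beta> \<noteq> 0\<close>, the flow is a pure swirl.

  On the open set where \<open>B \<noteq> 0\<close>, both \<open>u\<close> and \<open>B\<close> are therefore azimuthal.  The scalar product of
  the momentum equation with \<open>x\<close> then collapses to \<open>2 p = \<bar>B\<bar>\<^sup>2 - \<bar>u\<bar>\<^sup>2\<close> (\<open>pressure_\<Omega>\<close>), so the
  pressure is axisymmetric there; the vertical component says that \<open>p\<close> does not depend on the third
  coordinate, and the azimuthal component is a linear equation for \<open>w\<close>.  Consequently, on every
  interval on which \<open>\<beta> \<noteq> 0\<close>, the difference \<open>\<beta>\<^sup>2 - w\<^sup>2\<close> is constant and \<open>w\<close> is monotone.  A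
  monotone \<open>w\<close> has \<open>w\<^sup>2\<close> at an interior point bounded by the larger of its two end values, hence so
  has \<open>\<beta>\<^sup>2\<close>.  But \<open>\<beta>\<^sup>2\<close> tends to \<open>0\<close> at both ends of the line, so around a point with \<open>\<beta> \<noteq> 0\<close> there
  is an interval at whose ends \<open>\<beta>\<^sup>2\<close> is smaller than at the point (\<open>\<beta>_zero\<close>).  So \<open>B = 0\<close>.

  What remains is that a homogeneous solution \<open>u\<close>, \<open>p\<close> of the stationary Navier--Stokes equations away
  from the origin solves them on the whole space with a point force at the origin
  (\<open>homogeneous_navier_stokes_point_force\<close>).  Tested against functions that vanish near the origin,
  the weak equations follow from integration by parts.  Because the coefficients \<open>u\<close> and
  \<open>u \<otimes> u\<close>, \<open>p\<close> are of size \<open>1 / \<bar>x\<bar>\<close> and \<open>1 / \<bar>x\<bar>\<^sup>2\<close>, scale-invariant cut-offs are harmless for test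
  functions with \<open>\<psi> 0 = 0\<close>: all integrands stay below a multiple of the integrable function
  \<open>1 / \<bar>x\<bar>\<^sup>2\<close>.  So the weak functional only depends on \<open>\<psi> 0\<close>, and it depends on it linearly.
\<close>

section \<open>Partial derivatives and \<open>C\<^sup>k\<close> functions\<close>

lemma pd_eqI:
  assumes "(f has_derivative f') (at x)"
  shows "pd i f x = f' (axis i 1)"
  using frechet_derivative_at[OF assms] by (simp add: pd_def)

text \<open>Turns the basis-dependent \<open>pd\<close> into a full derivative, so that the chain rule becomes available.\<close>

lemma has_derivative_pd:
  fixes f :: "real^3 \<Rightarrow> 'b::real_normed_vector"
  assumes "f differentiable (at x)"
  shows "(f has_derivative (\<lambda>v. \<Sum>i\<in>UNIV. v $ i *\<^sub>R pd i f x)) (at x)"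
proof -
  let ?D = "frechet_derivative f (at x)"
  have D: "(f has_derivative ?D) (at x)"
    using assms frechet_derivative_works by blast
  then have lin: "linear ?D" by (rule has_derivative_linear)
  have "?D v = (\<Sum>i\<in>UNIV. v $ i *\<^sub>R pd i f x)" for v :: "real^3"
  proof -
    have "v = (\<Sum>i\<in>UNIV. v $ i *\<^sub>R axis i 1)"
      using basis_expansion[of v] by (simp add: scalar_mult_eq_scaleR)
    then have "?D v = ?D (\<Sum>i\<in>UNIV. v $ i *\<^sub>R axis i 1)" by simp
    also have "\<dots> = (\<Sum>i\<in>UNIV. v $ i *\<^sub>R ?D (axis i 1))"
      by (simp add: linear_sum[OF lin] linear_cmul[OF lin])
    finally show ?thesis by (simp add: pd_def)
  qed
  then have "?D = (\<lambda>v. \<Sum>i\<in>UNIV. v $ i *\<^sub>R pd i f x)" by auto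
  with D show ?thesis by simp
qed

lemma has_vector_derivative_pd_chain:
  fixes f :: "real^3 \<Rightarrow> 'b::real_normed_vector"
  assumes "f differentiable (at (c t))" "(c has_vector_derivative c') (at t)"
  shows "((\<lambda>t. f (c t)) has_vector_derivative (\<Sum>i\<in>UNIV. c' $ i *\<^sub>R pd i f (c t))) (at t)"
proof -
  have "((f \<circ> c) has_vector_derivative (\<Sum>i\<in>UNIV. c' $ i *\<^sub>R pd i f (c t))) (at t)"
    by (rule vector_derivative_diff_chain_within[OF assms(2)])
      (use has_derivative_pd[OF assms(1)] in \<open>auto intro: has_derivative_at_withinI\<close>)
  then show ?thesis by (simp add: o_def)
qed

text \<open>The choice made by \<open>frechet_derivative\<close> is from the set of all derivatives, and that set depends
  only on the germ of the function, also where it is empty.\<close>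

lemma pd_cong:
  assumes "open S" "x \<in> S" "\<And>y. y \<in> S \<Longrightarrow> f y = g y"
  shows "pd i f x = pd i g x"
proof -
  have "(f has_derivative D) (at x) \<longleftrightarrow> (g has_derivative D) (at x)" for D
    using has_derivative_transform_within_open[OF _ assms(1,2)] assms(3) by metis
  then show ?thesis by (simp add: pd_def frechet_derivative_def)
qed

lemma pd_const [simp]: "pd i (\<lambda>x. c) x = 0"
  by (subst pd_eqI[OF has_derivative_const]) simp

lemma pd_add:
  assumes "f differentiable (at x)" "g differentiable (at x)"
  shows "pd i (\<lambda>x. f x + g x) x = pd i f x + pd i g x"
  using pd_eqI[OF has_derivative_add[OF assms[unfolded frechet_derivative_works]]]
  by (simp add: pd_def)

lemma pd_minus:
  assumes "f differentiable (at x)"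
  shows "pd i (\<lambda>x. - f x) x = - pd i f x"
  using pd_eqI[OF has_derivative_minus[OF assms[unfolded frechet_derivative_works]]]
  by (simp add: pd_def)

lemma pd_diff:
  assumes "f differentiable (at x)" "g differentiable (at x)"
  shows "pd i (\<lambda>x. f x - g x) x = pd i f x - pd i g x"
  using pd_add[of f x "\<lambda>x. - g x" i] pd_minus[of g x i] assms by simp

text \<open>One product rule for multiplication, scaling and inner products.\<close>

lemma pd_bilinear:
  assumes "bounded_bilinear h" "f differentiable (at x)" "g differentiable (at x)"
  shows "pd i (\<lambda>x. h (f x) (g x)) x = h (f x) (pd i g x) + h (pd i f x) (g x)"
    and "(\<lambda>x. h (f x) (g x)) differentiable (at x)"
proof -
  have D: "((\<lambda>x. h (f x) (g x)) has_derivative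
    (\<lambda>v. h (f x) (frechet_derivative g (at x) v) + h (frechet_derivative f (at x) v) (g x))) (at x)"
    by (rule bounded_bilinear.FDERIV[OF assms(1)])
      (use assms frechet_derivative_works in blast)+
  from pd_eqI[OF D] show "pd i (\<lambda>x. h (f x) (g x)) x = h (f x) (pd i g x) + h (pd i f x) (g x)"
    by (simp add: pd_def)
  from D show "(\<lambda>x. h (f x) (g x)) differentiable (at x)" by (auto simp: differentiable_def)
qed

lemmas pd_mult = pd_bilinear(1)[OF bounded_bilinear_mult]
lemmas pd_inner = pd_bilinear(1)[OF bounded_bilinear_inner]

lemma pd_linear:
  assumes "bounded_linear h" "f differentiable (at x)"
  shows "pd i (\<lambda>x. h (f x)) x = h (pd i f x)"
    and "(\<lambda>x. h (f x)) differentiable (at x)"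
proof -
  have D: "((\<lambda>x. h (f x)) has_derivative (\<lambda>v. h (frechet_derivative f (at x) v))) (at x)"
    using assms bounded_linear.has_derivative frechet_derivative_works by blast
  from pd_eqI[OF D] show "pd i (\<lambda>x. h (f x)) x = h (pd i f x)" by (simp add: pd_def)
  from D show "(\<lambda>x. h (f x)) differentiable (at x)" by (auto simp: differentiable_def)
qed

lemmas pd_nth = pd_linear(1)[OF bounded_linear_vec_nth]
lemmas differentiable_nth = pd_linear(2)[OF bounded_linear_vec_nth]

lemma pd_id: "pd i (\<lambda>x. x) x = axis i 1"
  by (subst pd_eqI[OF has_derivative_ident]) simp

lemma Ck_on_cong:
  assumes "open S" "\<And>x. x \<in> S \<Longrightarrow> f x = g x" "Ck_on k f S"
  shows "Ck_on k g S"
  using assms(2,3)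
proof (induction k arbitrary: f g)
  case 0
  then show ?case by (metis Ck_on.simps(1) continuous_on_cong)
next
  case (Suc k)
  have "g differentiable (at x)" if "x \<in> S" for x
    using Suc.prems that assms(1) has_derivative_transform_within_open[of f _ x UNIV S g]
    unfolding Ck_on.simps differentiable_def by blast
  moreover have "Ck_on k (pd i g) S" for i
  proof (rule Suc.IH)
    show "pd i f x = pd i g x" if "x \<in> S" for x
      using pd_cong[OF assms(1) that] Suc.prems(1) by blast
    show "Ck_on k (pd i f) S" using Suc.prems by simp
  qed
  ultimately show ?case by simp
qed

lemma Ck_on_SucD: "Ck_on (Suc k) f S \<Longrightarrow> Ck_on k f S"
proof (induction k arbitrary: f)
  case 0
  then show ?case
    by (auto intro!: continuous_at_imp_continuous_on differentiable_imp_continuous_within)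
next
  case (Suc k)
  then show ?case by simp
qed

lemma Ck_on_continuous: "Ck_on k f S \<Longrightarrow> continuous_on S f"
  by (induction k) (auto dest: Ck_on_SucD simp del: Ck_on.simps(2))

lemma Ck_on_subset: "Ck_on k f S \<Longrightarrow> T \<subseteq> S \<Longrightarrow> Ck_on k f T"
  by (induction k arbitrary: f) (auto intro: continuous_on_subset)

text \<open>Used to glue a function across the origin: \<open>C\<^sup>k\<close> away from it and zero near it.\<close>

lemma Ck_on_union_open:
  "open S \<Longrightarrow> open T \<Longrightarrow> Ck_on k f S \<Longrightarrow> Ck_on k f T \<Longrightarrow> Ck_on k f (S \<union> T)"
  by (induction k arbitrary: f) (auto intro: continuous_on_open_Un)

lemma Ck_on_const: "Ck_on k (\<lambda>x. c) S"
proof (induction k arbitrary: c)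
  case (Suc k)
  have "pd i (\<lambda>x. c) = (\<lambda>x. 0)" for i and c :: 'a by (rule ext) simp
  with Suc show ?case by simp
qed simp

lemma Ck_on_add:
  assumes "open S"
  shows "Ck_on k f S \<Longrightarrow> Ck_on k g S \<Longrightarrow> Ck_on k (\<lambda>x. f x + g x) S"
proof (induction k arbitrary: f g)
  case (Suc k)
  have "Ck_on k (pd i (\<lambda>x. f x + g x)) S" for i
    by (rule Ck_on_cong[OF assms _ Suc.IH[of "pd i f" "pd i g"]]) (use Suc.prems in \<open>auto simp: pd_add\<close>)
  with Suc.prems show ?case by simp
qed (auto intro: continuous_intros)

lemma Ck_on_bilinear:
  assumes "open S" "bounded_bilinear h"
  shows "Ck_on k f S \<Longrightarrow> Ck_on k g S \<Longrightarrow> Ck_on k (\<lambda>x. h (f x) (g x)) S"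
proof (induction k arbitrary: f g)
  case 0
  then show ?case using bounded_bilinear.continuous_on[OF assms(2)] by auto
next
  case (Suc k)
  have "Ck_on k (\<lambda>x. h (f x) (pd i g x) + h (pd i f x) (g x)) S" for i
    using Suc.prems by (intro Ck_on_add assms Suc.IH Ck_on_SucD[of k f] Ck_on_SucD[of k g]) auto
  then have "Ck_on k (pd i (\<lambda>x. h (f x) (g x))) S" for i
    by (rule Ck_on_cong[OF assms(1), rotated]) (use Suc.prems in \<open>simp add: pd_bilinear(1)[OF assms(2)]\<close>)
  with Suc.prems show ?case by (simp add: pd_bilinear(2)[OF assms(2)])
qed

lemmas Ck_on_mult = Ck_on_bilinear[OF _ bounded_bilinear_mult]

lemma Ck_on_linear:
  assumes "open S" "bounded_linear h"
  shows "Ck_on k f S \<Longrightarrow> Ck_on k (\<lambda>x. h (f x)) S"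
proof (induction k arbitrary: f)
  case 0
  then show ?case using bounded_linear.continuous_on[OF assms(2)] by auto
next
  case (Suc k)
  have "Ck_on k (pd i (\<lambda>x. h (f x))) S" for i
    by (rule Ck_on_cong[OF assms(1) _ Suc.IH[of "pd i f"]])
      (use Suc.prems in \<open>auto simp: pd_linear(1)[OF assms(2)]\<close>)
  with Suc.prems show ?case by (simp add: pd_linear(2)[OF assms(2)])
qed

lemmas Ck_on_nth = Ck_on_linear[OF _ bounded_linear_vec_nth]
lemmas Ck_on_minus = Ck_on_linear[OF _ bounded_linear_minus[OF bounded_linear_ident]]

lemma Ck_on_diff:
  "open S \<Longrightarrow> Ck_on k f S \<Longrightarrow> Ck_on k g S \<Longrightarrow> Ck_on k (\<lambda>x. f x - g x) S"
  using Ck_on_add[of S k f "\<lambda>x. - g x"] Ck_on_minus[of S k g] by simp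

lemma Ck_on_id: "Ck_on k (\<lambda>x. x) S"
proof (cases k)
  case (Suc n)
  have "pd i (\<lambda>x. x) = (\<lambda>x. axis i 1)" for i by (rule ext) (rule pd_id)
  then show ?thesis by (simp add: Suc Ck_on_const)
qed (simp add: continuous_on_id)

section \<open>Homogeneous fields\<close>

text \<open>Euler's identity, by differentiating \<open>t \<mapsto> f (t x)\<close> at \<open>t = 1\<close>.\<close>

lemma homogeneous_euler:
  assumes "homogeneous k f" "f differentiable (at x)" "x \<noteq> 0"
  shows "(\<Sum>j\<in>UNIV. x $ j *\<^sub>R pd j f x) = of_int k *\<^sub>R f x"
proof -
  have "((\<lambda>t. t *\<^sub>R x) has_vector_derivative x) (at 1)"
    by (auto intro!: derivative_eq_intros)
  then have 1: "((\<lambda>t. f (t *\<^sub>R x)) has_vector_derivative (\<Sum>j\<in>UNIV. x $ j *\<^sub>R pd j f x)) (at 1)"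
    using has_vector_derivative_pd_chain[of f "\<lambda>t. t *\<^sub>R x" 1 x] assms(2) by simp
  have "((\<lambda>t. (t powi k) *\<^sub>R f x) has_vector_derivative of_int k *\<^sub>R f x) (at (1::real))"
    by (auto intro!: derivative_eq_intros)
  then have 2: "((\<lambda>t. f (t *\<^sub>R x)) has_vector_derivative of_int k *\<^sub>R f x) (at 1)"
    by (rule has_vector_derivative_transform_within_open[where S = "{0<..}"])
      (use assms in \<open>auto simp: homogeneous_def\<close>)
  show ?thesis using vector_derivative_unique_at[OF 1 2] .
qed

lemma homogeneous_pd:
  assumes "homogeneous k f" "\<And>x. x \<noteq> 0 \<Longrightarrow> f differentiable (at x)"
  shows "homogeneous (k - 1) (pd i f)"
  unfolding homogeneous_def
proof (intro allI impI)
  fix c :: real and x :: "real^3"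
  assume c: "0 < c" and x: "x \<noteq> 0"
  have "f differentiable (at (c *\<^sub>R x))" using assms(2) c x by simp
  then have "((\<lambda>y. f (c *\<^sub>R y)) has_derivative (\<lambda>v. \<Sum>j\<in>UNIV. (c *\<^sub>R v) $ j *\<^sub>R pd j f (c *\<^sub>R x))) (at x)"
    by (rule has_derivative_compose[OF has_derivative_scaleR_right[OF has_derivative_ident] has_derivative_pd])
  from pd_eqI[OF this, of i] have "pd i (\<lambda>y. f (c *\<^sub>R y)) x = (\<Sum>j\<in>UNIV. (if j = i then c *\<^sub>R pd j f (c *\<^sub>R x) else 0))"
    by (simp add: axis_def if_distrib[where f = "\<lambda>s. (c * s) *\<^sub>R _"] cong: if_cong)
  also have "\<dots> = c *\<^sub>R pd i f (c *\<^sub>R x)" by simp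
  finally have 1: "pd i (\<lambda>y. f (c *\<^sub>R y)) x = c *\<^sub>R pd i f (c *\<^sub>R x)" .
  have "pd i (\<lambda>y. f (c *\<^sub>R y)) x = pd i (\<lambda>y. (c powi k) *\<^sub>R f y) x"
    by (rule pd_cong[of "- {0}"]) (use x c assms(1) in \<open>auto simp: homogeneous_def\<close>)
  also have "\<dots> = (c powi k) *\<^sub>R pd i f x"
    using pd_linear(1)[OF bounded_linear_scaleR_right] assms(2)[OF x] .
  finally have "c *\<^sub>R pd i f (c *\<^sub>R x) = (c powi k) *\<^sub>R pd i f x" using 1 by simp
  then have "inverse c *\<^sub>R (c *\<^sub>R pd i f (c *\<^sub>R x)) = inverse c *\<^sub>R ((c powi k) *\<^sub>R pd i f x)" by simp
  then show "pd i f (c *\<^sub>R x) = c powi (k - 1) *\<^sub>R pd i f x"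
    using c by (simp add: power_int_diff field_simps)
qed

text \<open>By scaling, a homogeneous field is controlled by its maximum on the compact unit sphere.\<close>

lemma homogeneous_bounded:
  assumes "homogeneous k f" "continuous_on (- {0}) f"
  obtains C where "C \<ge> 0" "\<And>x. x \<noteq> 0 \<Longrightarrow> norm (f x) \<le> C * norm x powi k"
proof -
  have "compact (f ` sphere 0 1)"
    by (rule compact_continuous_image) (use assms(2) in \<open>auto elim: continuous_on_subset\<close>)
  then obtain C where C: "C > 0" "\<And>y. y \<in> sphere 0 1 \<Longrightarrow> norm (f y) \<le> C"
    using bounded_pos[of "f ` sphere 0 1"] compact_imp_bounded by (metis image_eqI)
  show ?thesis
  proof (rule that[of C])
    fix x :: "real^3" assume "x \<noteq> 0"
    then have "f x = (norm x powi k) *\<^sub>R f ((1 / norm x) *\<^sub>R x)"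
      using assms(1)[unfolded homogeneous_def, rule_format, of "norm x" "(1 / norm x) *\<^sub>R x"] by simp
    then have "norm (f x) = norm (f ((1 / norm x) *\<^sub>R x)) * norm x powi k"
      by (metis abs_norm_cancel mult.commute norm_scaleR power_int_abs real_norm_def)
    moreover have "norm (f ((1 / norm x) *\<^sub>R x)) \<le> C" using C(2) \<open>x \<noteq> 0\<close> by simp
    ultimately show "norm (f x) \<le> C * norm x powi k"
      by (simp add: mult_right_mono)
  qed (use C in simp)
qed

section \<open>Axisymmetric homogeneous fields along a vertical line\<close>

text \<open>Cylindrical coordinates at distance \<open>1\<close> from the axis.  By homogeneity these points represent all
  points off the axis, and the line \<open>t = 0\<close> represents all of them up to rotation.\<close>

definition cyl :: "real \<Rightarrow> real \<Rightarrow> real^3" where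
  "cyl t z = vector [cos t, sin t, z]"

definition rotz :: "real \<Rightarrow> real^3 \<Rightarrow> real^3" where
  "rotz t v = vector [cos t * v $ 1 - sin t * v $ 2, sin t * v $ 1 + cos t * v $ 2, v $ 3]"

lemma vec3_eq_iff: "(x :: real^3) = y \<longleftrightarrow> x $ 1 = y $ 1 \<and> x $ 2 = y $ 2 \<and> x $ 3 = y $ 3"
  by (simp add: vec_eq_iff forall_3)

lemma cyl_nth [simp]: "cyl t z $ 1 = cos t" "cyl t z $ 2 = sin t" "cyl t z $ 3 = z"
  by (simp_all add: cyl_def)

lemma rotz_nth [simp]: "rotz t v $ 1 = cos t * v $ 1 - sin t * v $ 2"
  "rotz t v $ 2 = sin t * v $ 1 + cos t * v $ 2" "rotz t v $ 3 = v $ 3"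
  by (simp_all add: rotz_def)

lemma rotz_0 [simp]: "rotz 0 v = v"
  by (simp add: vec3_eq_iff)

lemma cyl_nonzero [simp]: "cyl t z \<noteq> 0"
proof
  assume "cyl t z = 0"
  then have "cos t = 0" "sin t = 0" by (simp_all add: vec3_eq_iff)
  then show False using sin_zero_abs_cos_one by fastforce
qed

lemma inner_3: "(x :: real^3) \<bullet> y = x $ 1 * y $ 1 + x $ 2 * y $ 2 + x $ 3 * y $ 3"
  by (simp add: inner_vec_def sum_3)

lemma norm_rotz: "norm (rotz t v) = norm v"
proof -
  have "(cos t * v $ 1 - sin t * v $ 2)\<^sup>2 + (sin t * v $ 1 + cos t * v $ 2)\<^sup>2
    = ((sin t)\<^sup>2 + (cos t)\<^sup>2) * ((v $ 1)\<^sup>2 + (v $ 2)\<^sup>2)"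
    by (simp only: power2_eq_square) algebra
  then have "rotz t v \<bullet> rotz t v = v \<bullet> v"
    unfolding inner_3 by (simp flip: power2_eq_square)
  then show ?thesis by (simp add: norm_eq_sqrt_inner)
qed

lemma norm_cyl: "norm (cyl t z) = sqrt (1 + z\<^sup>2)"
  by (simp add: norm_eq_sqrt_inner inner_3 flip: power2_eq_square)

lemma cyl_spherical:
  obtains \<rho> \<phi> where "\<rho> > 0" "0 < \<phi>" "\<phi> < pi" "\<rho> * sin \<phi> = 1" "\<And>t. cyl t z = spherical \<rho> t \<phi>"
proof -
  define \<rho> where "\<rho> = sqrt (1 + z\<^sup>2)"
  define \<phi> where "\<phi> = arccos (z / \<rho>)"
  have \<rho>: "\<rho> > 0" "\<rho>\<^sup>2 = 1 + z\<^sup>2" by (simp_all add: \<rho>_def add_pos_nonneg)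
  then have "\<bar>z\<bar> < \<rho>" by (simp add: \<rho>_def real_less_rsqrt)
  then have z: "- 1 < z / \<rho>" "z / \<rho> < 1" using \<rho>(1) by (auto simp: field_simps)
  have cos: "\<rho> * cos \<phi> = z" using z \<rho> by (simp add: \<phi>_def)
  have \<phi>: "0 < \<phi>" "\<phi> < pi" using arccos_lt_bounded[OF z] by (simp_all add: \<phi>_def)
  have "(\<rho> * sin \<phi>)\<^sup>2 = \<rho>\<^sup>2 - (\<rho> * cos \<phi>)\<^sup>2"
    by (simp add: power_mult_distrib sin_squared_eq right_diff_distrib)
  then have "(\<rho> * sin \<phi>)\<^sup>2 = 1" using cos \<rho> by simp
  moreover have "\<rho> * sin \<phi> > 0" using \<rho> \<phi> by (simp add: sin_gt_zero)
  ultimately have sin: "\<rho> * sin \<phi> = 1" by (auto simp: power2_eq_1_iff)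
  show ?thesis
    by (rule that[OF \<rho>(1) \<phi> sin]) (simp add: cyl_def spherical_def sin cos)
qed

text \<open>Rotations turn the moving frame along with the point, so constant components in that frame mean
  equivariance.\<close>

lemma axisymmetric_cyl:
  assumes "axisymmetric v"
  shows "v (cyl t z) = rotz t (v (cyl 0 z))"
proof -
  obtain \<rho> \<phi> where c: "\<rho> > 0" "0 < \<phi>" "\<phi> < pi" "\<And>t. cyl t z = spherical \<rho> t \<phi>"
    using cyl_spherical by metis
  obtain a b d where v: "\<And>t. v (spherical \<rho> t \<phi>) = a *\<^sub>R e_rho t \<phi> + b *\<^sub>R e_theta t + d *\<^sub>R e_phi t \<phi>"
    using assms c(1-3) unfolding axisymmetric_def by metis
  show ?thesis
    unfolding c(4) v by (simp add: vec3_eq_iff e_rho_def e_theta_def e_phi_def algebra_simps)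
qed

lemma off_axis_cyl:
  assumes "x $ 1 \<noteq> 0 \<or> x $ 2 \<noteq> (0::real)"
  obtains r t z where "r > 0" "x = r *\<^sub>R cyl t z"
proof -
  define r where "r = sqrt ((x $ 1)\<^sup>2 + (x $ 2)\<^sup>2)"
  have "(x $ 1)\<^sup>2 + (x $ 2)\<^sup>2 > 0" using assms unfolding sum_power2_gt_zero_iff by blast
  then have r: "r > 0" "r\<^sup>2 = (x $ 1)\<^sup>2 + (x $ 2)\<^sup>2"
    by (simp_all add: r_def)
  have "(x $ 1 / r)\<^sup>2 + (x $ 2 / r)\<^sup>2 = ((x $ 1)\<^sup>2 + (x $ 2)\<^sup>2) / r\<^sup>2"
    by (simp only: power_divide add_divide_distrib)
  also have "\<dots> = 1" unfolding r(2)[symmetric] using r(1) by simp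
  finally have "(x $ 1 / r)\<^sup>2 + (x $ 2 / r)\<^sup>2 = 1" .
  then obtain t where "x $ 1 / r = cos t" "x $ 2 / r = sin t" using sincos_total_2pi by metis
  then have "x = r *\<^sub>R cyl t (x $ 3 / r)" using r(1) by (auto simp: vec3_eq_iff field_simps)
  with r(1) that show ?thesis by blast
qed

lemma has_vector_derivative_vec3:
  fixes f g h :: "real \<Rightarrow> real"
  assumes "(f has_real_derivative f') (at t)" "(g has_real_derivative g') (at t)"
    "(h has_real_derivative h') (at t)"
  shows "((\<lambda>t. vector [f t, g t, h t] :: real^3) has_vector_derivative vector [f', g', h']) (at t)"
proof -
  have *: "vector [a, b, c] = a *\<^sub>R axis 1 1 + b *\<^sub>R axis 2 1 + c *\<^sub>R (axis 3 1 :: real^3)" for a b c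
    by (simp add: vec3_eq_iff axis_def)
  have s: "((\<lambda>t. k t *\<^sub>R c) has_vector_derivative k' *\<^sub>R c) (at t)"
    if "(k has_real_derivative k') (at t)" for k k' and c :: "real^3"
    using has_vector_derivative_scaleR[OF that has_vector_derivative_const] by simp
  show ?thesis
    unfolding * by (intro has_vector_derivative_add s assms)
qed

lemma has_vector_derivative_cyl_z: "(cyl t has_vector_derivative axis 3 1) (at z)"
proof -
  have "((\<lambda>z. vector [cos t, sin t, z] :: real^3) has_vector_derivative vector [0, 0, 1]) (at z)"
    by (intro has_vector_derivative_vec3) (auto intro!: derivative_eq_intros)
  moreover have "vector [0, 0, 1] = (axis 3 1 :: real^3)" by (simp add: vec3_eq_iff axis_def)
  moreover have "cyl t = (\<lambda>z. vector [cos t, sin t, z])" by (auto simp: cyl_def)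
  ultimately show ?thesis by simp
qed

lemma has_vector_derivative_cyl_t:
  "((\<lambda>t. cyl t z) has_vector_derivative vector [- sin t, cos t, 0]) (at t)"
  unfolding cyl_def by (intro has_vector_derivative_vec3) (auto intro!: derivative_eq_intros)

lemma along_cyl_z:
  fixes f :: "real^3 \<Rightarrow> 'b::real_normed_vector"
  assumes "f differentiable (at (cyl t z))"
  shows "((\<lambda>z. f (cyl t z)) has_vector_derivative pd 3 f (cyl t z)) (at z)"
  using has_vector_derivative_pd_chain[OF assms has_vector_derivative_cyl_z]
  by (simp add: sum_3 axis_def)

lemma along_cyl_t:
  fixes f :: "real^3 \<Rightarrow> 'b::real_normed_vector"
  assumes "f differentiable (at (cyl t z))"
  shows "((\<lambda>t. f (cyl t z)) has_vector_derivative
    - sin t *\<^sub>R pd 1 f (cyl t z) + cos t *\<^sub>R pd 2 f (cyl t z)) (at t)"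
  using has_vector_derivative_pd_chain[OF assms has_vector_derivative_cyl_t]
  by (simp add: sum_3)

text \<open>Such a field is a function of one variable, its restriction to the line \<open>cyl 0 z\<close>.  The identities
  below reduce all first and second partial derivatives on that line to \<open>pd 3\<close>.\<close>

locale axisymmetric_homogeneous =
  fixes v :: "real^3 \<Rightarrow> real^3"
  assumes C2: "Ck_on 2 v (- {0})"
    and rot: "\<And>t z. v (cyl t z) = rotz t (v (cyl 0 z))"
    and hom: "homogeneous (- 1) v"
begin

lemma diff: "x \<noteq> 0 \<Longrightarrow> v differentiable (at x)"
  using C2 by (simp add: numeral_2_eq_2)

lemma diff_pd: "x \<noteq> 0 \<Longrightarrow> pd i v differentiable (at x)"
  using C2 by (simp add: numeral_2_eq_2)

lemma pd1: "pd 1 v (cyl 0 z) = - v (cyl 0 z) - z *\<^sub>R pd 3 v (cyl 0 z)"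
  using homogeneous_euler[OF hom diff[of "cyl 0 z"]] 
  by (simp add: sum_3 algebra_simps eq_neg_iff_add_eq_0)

text \<open>The derivative along the rotation circle through \<open>cyl 0 z\<close>.  It is stated for all angles because
  it is differentiated once more to obtain \<open>pd 2 (pd 2 v)\<close>.\<close>

lemma rotation_derivative:
  "- sin t *\<^sub>R pd 1 v (cyl t z) + cos t *\<^sub>R pd 2 v (cyl t z)
    = vector [- sin t * v (cyl 0 z) $ 1 - cos t * v (cyl 0 z) $ 2,
              cos t * v (cyl 0 z) $ 1 - sin t * v (cyl 0 z) $ 2, 0]"
proof -
  define w where "w = v (cyl 0 z)"
  have "((\<lambda>t. rotz t w) has_vector_derivative
    vector [- sin t * w $ 1 - cos t * w $ 2, cos t * w $ 1 - sin t * w $ 2, 0]) (at t)"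
    unfolding rotz_def
    by (intro has_vector_derivative_vec3) (auto intro!: derivative_eq_intros)
  moreover have "(\<lambda>t. v (cyl t z)) = (\<lambda>t. rotz t w)"
    unfolding w_def using rot by (intro ext)
  ultimately show ?thesis
    using along_cyl_t[OF diff[OF cyl_nonzero]] unfolding w_def
    by (metis vector_derivative_unique_at)
qed

lemma pd2: "pd 2 v (cyl 0 z) = vector [- v (cyl 0 z) $ 2, v (cyl 0 z) $ 1, 0]"
  using rotation_derivative[of 0 z] by simp

lemma pd22: "pd 2 (pd 2 v) (cyl 0 z) = pd 1 v (cyl 0 z) - vector [v (cyl 0 z) $ 1, v (cyl 0 z) $ 2, 0]"
proof -
  have "((\<lambda>t. - sin t *\<^sub>R pd 1 v (cyl t z) + cos t *\<^sub>R pd 2 v (cyl t z)) has_vector_derivative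
      - pd 1 v (cyl 0 z) + pd 2 (pd 2 v) (cyl 0 z)) (at 0)"
  proof -
    have "((\<lambda>t. - sin t) has_real_derivative - 1) (at 0)" "(cos has_real_derivative 0) (at 0)"
      by (auto intro!: derivative_eq_intros)
    note has_vector_derivative_add[OF
        has_vector_derivative_scaleR[OF this(1) along_cyl_t[OF diff_pd[of "cyl 0 z" 1]]]
        has_vector_derivative_scaleR[OF this(2) along_cyl_t[OF diff_pd[of "cyl 0 z" 2]]]]
    then show ?thesis by simp
  qed
  moreover have "((\<lambda>t. - sin t *\<^sub>R pd 1 v (cyl t z) + cos t *\<^sub>R pd 2 v (cyl t z)) has_vector_derivative
      vector [- v (cyl 0 z) $ 1, - v (cyl 0 z) $ 2, 0]) (at 0)"
    unfolding rotation_derivative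
    by (intro has_vector_derivative_vec3) (auto intro!: derivative_eq_intros)
  ultimately have "- pd 1 v (cyl 0 z) + pd 2 (pd 2 v) (cyl 0 z) = vector [- v (cyl 0 z) $ 1, - v (cyl 0 z) $ 2, 0]"
    by (rule vector_derivative_unique_at)
  then show ?thesis by (auto simp: vec3_eq_iff)
qed

text \<open>Euler's identity for the field \<open>pd 1 v\<close>, which is homogeneous of degree \<open>-2\<close>; its mixed derivative
  \<open>pd 3 (pd 1 v)\<close> comes from differentiating \<open>pd1\<close> along the line.\<close>

lemma pd11: "pd 1 (pd 1 v) (cyl 0 z)
  = 2 *\<^sub>R v (cyl 0 z) + (4 * z) *\<^sub>R pd 3 v (cyl 0 z) + z\<^sup>2 *\<^sub>R pd 3 (pd 3 v) (cyl 0 z)"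
proof -
  have "((\<lambda>z. pd 1 v (cyl 0 z)) has_vector_derivative
    - 2 *\<^sub>R pd 3 v (cyl 0 z) - z *\<^sub>R pd 3 (pd 3 v) (cyl 0 z)) (at z)"
  proof -
    have "((\<lambda>z. z) has_real_derivative 1) (at z)" by (rule DERIV_ident)
    note has_vector_derivative_diff[OF
        has_vector_derivative_minus[OF along_cyl_z[OF diff[of "cyl 0 z"]]]
        has_vector_derivative_scaleR[OF this along_cyl_z[OF diff_pd[of "cyl 0 z" 3]]]]
    then show ?thesis unfolding pd1 by (simp add: vec3_eq_iff algebra_simps scaleR_2)
  qed
  with along_cyl_z[OF diff_pd[of "cyl 0 z" 1]]
  have 31: "pd 3 (pd 1 v) (cyl 0 z) = - 2 *\<^sub>R pd 3 v (cyl 0 z) - z *\<^sub>R pd 3 (pd 3 v) (cyl 0 z)"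
    by (auto dest: vector_derivative_unique_at)
  have 11: "pd 1 (pd 1 v) (cyl 0 z) = - 2 *\<^sub>R pd 1 v (cyl 0 z) - z *\<^sub>R pd 3 (pd 1 v) (cyl 0 z)"
    using homogeneous_euler[OF homogeneous_pd[OF hom diff, of 1] diff_pd[of "cyl 0 z"]]
    by (simp add: sum_3 algebra_simps)
  show ?thesis
    unfolding 11 31 pd1 by (simp add: vec3_eq_iff algebra_simps power2_eq_square)
qed

lemma DERIV_z: "((\<lambda>z. v (cyl 0 z) $ k) has_real_derivative pd 3 v (cyl 0 z) $ k) (at z)"
  unfolding has_real_derivative_iff_has_vector_derivative
  using bounded_linear.has_vector_derivative[OF bounded_linear_vec_nth along_cyl_z[OF diff[OF cyl_nonzero]]] .

lemma DERIV_z_pd3: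
  "((\<lambda>z. pd 3 v (cyl 0 z) $ k) has_real_derivative pd 3 (pd 3 v) (cyl 0 z) $ k) (at z)"
  unfolding has_real_derivative_iff_has_vector_derivative
  using bounded_linear.has_vector_derivative[OF bounded_linear_vec_nth along_cyl_z[OF diff_pd[OF cyl_nonzero]]] .

text \<open>On the line, \<open>norm (cyl t z)\<close> is \<open>sqrt (1 + z\<^sup>2)\<close>, so homogeneity of degree \<open>-1\<close> becomes decay as
  \<open>z\<close> tends to infinity.\<close>

lemma decay:
  obtains C where "C \<ge> 0" "\<And>t z k. \<bar>v (cyl t z) $ k\<bar> \<le> C / sqrt (1 + z\<^sup>2)"
proof -
  obtain C where C: "C \<ge> 0" "\<And>x. x \<noteq> 0 \<Longrightarrow> norm (v x) \<le> C * norm x powi - 1"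
    using homogeneous_bounded[OF hom Ck_on_continuous[OF C2]] by blast
  show ?thesis
  proof (rule that[OF C(1)])
    fix t z k
    have "\<bar>v (cyl t z) $ k\<bar> \<le> norm (v (cyl t z))" by (metis component_le_norm_cart)
    also have "\<dots> \<le> C / sqrt (1 + z\<^sup>2)"
      using C(2)[of "cyl t z"] by (simp add: norm_cyl divide_inverse)
    finally show "\<bar>v (cyl t z) $ k\<bar> \<le> C / sqrt (1 + z\<^sup>2)" .
  qed
qed

lemma scale_cyl:
  assumes "r > 0"
  shows "v (r *\<^sub>R cyl t z) = (1 / r) *\<^sub>R rotz t (v (cyl 0 z))"
  using hom[unfolded homogeneous_def, rule_format, OF assms, of "cyl t z"] rot[of t z]
  by (simp add: divide_inverse)

text \<open>The azimuthal component involves neither of the two other components, which makes the swirl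
  equation a linear equation in one unknown.\<close>

lemma laplacian_swirl: "laplacian v (cyl 0 z) $ 2
  = (1 + z\<^sup>2) * pd 3 (pd 3 v) (cyl 0 z) $ 2 + 3 * z * pd 3 v (cyl 0 z) $ 2"
  unfolding laplacian_def by (simp add: sum_3 pd11 pd22 pd1 algebra_simps)

end

section \<open>Vanishing of a toroidal magnetic field\<close>

text \<open>Take the largest solution of \<open>H z = c\<close> below \<open>z0\<close>; the intermediate value theorem forbids a value
  below \<open>c\<close> after it.\<close>

lemma last_point_at_level:
  fixes H :: "real \<Rightarrow> real"
  assumes "continuous_on {y..z0} H" "y < z0" "H y < c" "c < H z0"
  obtains z1 where "y < z1" "z1 < z0" "H z1 = c" "\<And>z. z1 \<le> z \<Longrightarrow> z \<le> z0 \<Longrightarrow> c \<le> H z"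
proof -
  let ?S = "{z \<in> {y..z0}. H z = c}"
  have "closed ?S"
    using continuous_closed_preimage_constant[OF assms(1) closed_atLeastAtMost] .
  then have cS: "compact ?S"
    by (metis (lifting) bounded_closed_interval bounded_subset compact_eq_bounded_closed mem_Collect_eq subsetI)
  have ne: "?S \<noteq> {}"
    using IVT'[of H y c z0] assms by auto
  obtain z1 where z1: "z1 \<in> ?S" and max: "\<And>z. z \<in> ?S \<Longrightarrow> z \<le> z1"
    using compact_attains_sup[OF cS ne] by blast
  have "z1 \<noteq> y" "z1 \<noteq> z0" using z1 assms by auto
  moreover have "c \<le> H z" if z: "z1 \<le> z" "z \<le> z0" for z
  proof (rule ccontr)
    assume "\<not> c \<le> H z"
    moreover have "continuous_on {z..z0} H"
      by (rule continuous_on_subset[OF assms(1)]) (use z1 z in auto)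
    ultimately obtain y' where "z \<le> y'" "y' \<le> z0" "H y' = c"
      using IVT'[of H z c z0] assms(4) z(2) by (auto simp: not_le)
    with max[of y'] z1 z have "y' = z" by auto
    with \<open>H y' = c\<close> \<open>\<not> c \<le> H z\<close> show False by simp
  qed
  ultimately show ?thesis using that[of z1] z1 by auto
qed

text \<open>A continuous function that drops below \<open>c\<close> on both sides of \<open>z0\<close> is cut off at level \<open>c\<close>; the
  second half is the reflection of \<open>last_point_at_level\<close>.\<close>

lemma level_interval:
  fixes H :: "real \<Rightarrow> real"
  assumes "continuous_on UNIV H" "y < z0" "z0 < y'" "H y < c" "H y' < c" "c < H z0"
  obtains z1 z2 where "z1 < z0" "z0 < z2" "H z1 = c" "H z2 = c" "\<And>z. z \<in> {z1..z2} \<Longrightarrow> c \<le> H z"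
proof -
  obtain z1 where z1: "z1 < z0" "H z1 = c" "\<And>z. z1 \<le> z \<Longrightarrow> z \<le> z0 \<Longrightarrow> c \<le> H z"
    using last_point_at_level[OF continuous_on_subset[OF assms(1)], of y z0 c] assms by auto
  have "continuous_on {- y'..- z0} (\<lambda>z. H (- z))"
    by (rule continuous_on_compose2[OF assms(1)]) (auto intro: continuous_intros)
  then obtain z2 where z2: "z2 < - z0" "H (- z2) = c" "\<And>z. z2 \<le> z \<Longrightarrow> z \<le> - z0 \<Longrightarrow> c \<le> H (- z)"
    using last_point_at_level[of "- y'" "- z0" "\<lambda>z. H (- z)" c] assms by auto
  show ?thesis
  proof (rule that[of z1 "- z2"])
    show "c \<le> H z" if "z \<in> {z1..- z2}" for z
      using z1(3)[of z] z2(3)[of "- z"] that by (cases "z \<le> z0") auto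
  qed (use z1 z2 in auto)
qed

lemma square_between:
  fixes a b c :: real
  assumes "(a \<le> b \<and> b \<le> c) \<or> (a \<ge> b \<and> b \<ge> c)"
  shows "b\<^sup>2 \<le> a\<^sup>2 \<or> b\<^sup>2 \<le> c\<^sup>2"
  using assms by (auto simp flip: abs_le_square_iff)

lemma open_off_axis: "open {x :: real^3. x $ 1 \<noteq> 0 \<or> x $ 2 \<noteq> 0}"
  by (intro open_Collect_disj open_Collect_neq continuous_intros)

text \<open>For a field tangent to the spheres around the origin the radial part of \<open>(v \<cdot> \<nabla>) v\<close> is the
  centripetal term: differentiate \<open>y \<bullet> v y = 0\<close> in the direction \<open>v\<close>.\<close>

lemma tangential_advection:
  assumes "open S" "x \<in> S" "v differentiable (at x)" "\<And>y. y \<in> S \<Longrightarrow> y \<bullet> v y = 0"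
  shows "x \<bullet> advection v v x = - (v x \<bullet> v x)"
proof -
  have j: "x \<bullet> pd j v x = - (v x $ j)" for j
  proof -
    have "pd j (\<lambda>y. y \<bullet> v y) x = 0" using pd_cong[OF assms(1,2,4)] by simp
    then show ?thesis
      using pd_inner[of "\<lambda>y. y" x v j] assms(3) by (simp add: pd_id inner_axis' )
  qed
  have "x \<bullet> advection v v x = (\<Sum>j\<in>UNIV. - (v x $ j * v x $ j))"
    unfolding advection_def by (simp add: inner_sum_right j)
  then show ?thesis by (simp add: inner_vec_def sum_negf)
qed

text \<open>Expand \<open>0 = \<Delta> (y \<bullet> v y)\<close> with the product rule.\<close>

lemma tangential_laplacian:
  assumes "open S" "x \<in> S" "Ck_on 2 v S" "\<And>y. y \<in> S \<Longrightarrow> y \<bullet> v y = 0"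
  shows "x \<bullet> laplacian v x = - 2 * divergence v x"
proof -
  have d: "v differentiable (at y)" "pd i v differentiable (at y)" if "y \<in> S" for y i
    using assms(3) that by (simp_all add: numeral_2_eq_2)
  have 1: "v y $ j + y \<bullet> pd j v y = 0" if "y \<in> S" for y j
  proof -
    have "pd j (\<lambda>y. y \<bullet> v y) y = 0" using pd_cong[OF assms(1) that assms(4)] by simp
    then show ?thesis
      using pd_inner[of "\<lambda>y. y" y v j] d(1)[OF that] by (simp add: pd_id inner_axis')
  qed
  have 2: "x \<bullet> pd j (pd j v) x = - 2 * pd j v x $ j" for j
  proof -
    have "pd j (\<lambda>y. v y $ j + y \<bullet> pd j v y) x = 0" using pd_cong[OF assms(1,2) 1] by simp
    moreover have "(\<lambda>y. y \<bullet> pd j v y) differentiable (at x)"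
      using d(2)[OF assms(2)] by (intro pd_bilinear(2)[OF bounded_bilinear_inner]) auto
    ultimately show ?thesis
      using pd_inner[of "\<lambda>y. y" x "pd j v" j] d[OF assms(2)]
      by (simp add: pd_add differentiable_nth pd_nth pd_id inner_axis')
  qed
  show ?thesis
    by (simp add: laplacian_def divergence_def inner_sum_right 2 sum_distrib_left)
qed

lemma component_zero:
  assumes "open S" "x \<in> S" "Ck_on 2 v S" "\<And>y. y \<in> S \<Longrightarrow> v y $ k = 0"
  shows "pd i v x $ k = 0" "pd j (pd i v) x $ k = 0"
proof -
  have d: "v differentiable (at y)" "pd i v differentiable (at y)" if "y \<in> S" for y
    using assms(3) that by (simp_all add: numeral_2_eq_2)
  have 1: "pd i v y $ k = 0" if "y \<in> S" for y
    using pd_cong[OF assms(1) that assms(4)] pd_nth[OF d(1)[OF that], of i k] by simp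
  show "pd i v x $ k = 0" "pd j (pd i v) x $ k = 0"
    using 1 assms(2) pd_cong[OF assms(1,2) 1] pd_nth[OF d(2)[OF assms(2)], of j k] by auto
qed

text \<open>The equations for a viscous fluid without magnetic diffusion.  That \<open>B\<close> is azimuthal is a condition
  on the line \<open>cyl 0 z\<close> only: rotations and scalings carry it to all points off the axis.\<close>

locale toroidal_mhd = U: axisymmetric_homogeneous u + B: axisymmetric_homogeneous B
  for u B :: "real^3 \<Rightarrow> real^3" +
  fixes p :: "real^3 \<Rightarrow> real"
  assumes p_diff: "\<And>x. x \<noteq> 0 \<Longrightarrow> p differentiable (at x)"
    and p_hom: "homogeneous (- 2) p"
    and momentum: "\<And>x. x \<noteq> 0 \<Longrightarrow>
      - laplacian u x + advection u u x - advection B B x + gradient p x = 0"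
    and induction_eq: "\<And>x. x \<noteq> 0 \<Longrightarrow> advection u B x = advection B u x"
    and div_u: "\<And>x. x \<noteq> 0 \<Longrightarrow> divergence u x = 0"
    and toroidal: "B (cyl 0 z) $ 1 = 0" "B (cyl 0 z) $ 3 = 0"
begin

definition \<beta> :: "real \<Rightarrow> real" where "\<beta> z = B (cyl 0 z) $ 2"

text \<open>The Stokes stream function of \<open>u\<close> at distance \<open>1\<close> from the axis: \<open>2 \<pi> V z\<close> is the flux of \<open>u\<close>
  through the horizontal disk bounded by the circle through \<open>cyl 0 z\<close>.  Homogeneity expresses this
  flux by the values on the circle.\<close>

definition V :: "real \<Rightarrow> real" where "V z = u (cyl 0 z) $ 3 - z * u (cyl 0 z) $ 1"

lemma DERIV_V: "(V has_real_derivative - u (cyl 0 z) $ 1) (at z)"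
proof -
  have "pd 3 u (cyl 0 z) $ 3 = z * pd 3 u (cyl 0 z) $ 1"
    using div_u[of "cyl 0 z"] by (simp add: divergence_def sum_3 U.pd1 U.pd2)
  then show ?thesis
    unfolding V_def
    using DERIV_diff[OF U.DERIV_z[of 3 z] DERIV_mult[OF DERIV_ident U.DERIV_z[of 1 z]]] by simp
qed

lemma DERIV_\<beta>: "(\<beta> has_real_derivative pd 3 B (cyl 0 z) $ 2) (at z)"
  using B.DERIV_z[of 2 z] by (simp add: \<beta>_def[abs_def])

text \<open>The azimuthal component of the induction equation; the swirl component of \<open>u\<close> drops out because
  \<open>B\<close> has no radial component.\<close>

lemma induction_z: "V z * pd 3 B (cyl 0 z) $ 2 = 2 * u (cyl 0 z) $ 1 * \<beta> z"
proof -
  have "advection u B (cyl 0 z) $ 2 = advection B u (cyl 0 z) $ 2" by (simp add: induction_eq)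
  then show ?thesis
    by (simp add: advection_def sum_3 B.pd1 B.pd2 U.pd2 toroidal V_def \<beta>_def algebra_simps)
qed

text \<open>The derivative of \<open>V\<^sup>2 \<beta>\<close> is \<open>V (V \<beta>' - 2 a \<beta>) = 0\<close>, where \<open>a\<close> is the radial component of \<open>u\<close>.
  The constant vanishes because \<open>V\<close> is bounded and \<open>\<beta>\<close> decays.\<close>

lemma flux_zero: "(V z)\<^sup>2 * \<beta> z = 0"
proof -
  have "((\<lambda>z. (V z)\<^sup>2 * \<beta> z) has_real_derivative 0) (at z)" for z
  proof -
    have "((\<lambda>z. (V z)\<^sup>2 * \<beta> z) has_real_derivative
      (2 * V z * (- u (cyl 0 z) $ 1)) * \<beta> z + pd 3 B (cyl 0 z) $ 2 * (V z)\<^sup>2) (at z)"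
      by (rule derivative_eq_intros DERIV_V DERIV_\<beta> refl | simp)+
    moreover have "(2 * V z * (- u (cyl 0 z) $ 1)) * \<beta> z + pd 3 B (cyl 0 z) $ 2 * (V z)\<^sup>2
      = V z * (V z * pd 3 B (cyl 0 z) $ 2 - 2 * u (cyl 0 z) $ 1 * \<beta> z)"
      by (simp add: algebra_simps power2_eq_square)
    ultimately show ?thesis using induction_z[of z] by simp
  qed
  then have const: "(V z)\<^sup>2 * \<beta> z = (V y)\<^sup>2 * \<beta> y" for y
    using DERIV_isconst_all by blast
  obtain C where C: "C \<ge> 0" "\<And>t z k. \<bar>u (cyl t z) $ k\<bar> \<le> C / sqrt (1 + z\<^sup>2)"
    using U.decay by blast
  obtain D where D: "D \<ge> 0" "\<And>t z k. \<bar>B (cyl t z) $ k\<bar> \<le> D / sqrt (1 + z\<^sup>2)"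
    using B.decay by blast
  have V: "\<bar>V y\<bar> \<le> 2 * C" for y
  proof -
    have s: "\<bar>y\<bar> \<le> sqrt (1 + y\<^sup>2)" "1 \<le> sqrt (1 + y\<^sup>2)"
      by (simp_all add: real_le_rsqrt)
    then have s0: "sqrt (1 + y\<^sup>2) > 0" by linarith
    have "\<bar>V y\<bar> \<le> \<bar>u (cyl 0 y) $ 3\<bar> + \<bar>y\<bar> * \<bar>u (cyl 0 y) $ 1\<bar>"
      unfolding V_def using abs_triangle_ineq4 by (metis abs_mult)
    also have "\<dots> \<le> C / sqrt (1 + y\<^sup>2) + \<bar>y\<bar> * (C / sqrt (1 + y\<^sup>2))"
      by (intro add_mono mult_left_mono C) simp
    also have "\<dots> = (1 + \<bar>y\<bar>) * C / sqrt (1 + y\<^sup>2)" by (simp add: field_simps add_divide_distrib)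
    also have "\<dots> \<le> (sqrt (1 + y\<^sup>2) + sqrt (1 + y\<^sup>2)) * C / sqrt (1 + y\<^sup>2)"
      using s s0 C(1) by (intro divide_right_mono mult_right_mono add_mono) auto
    also have "\<dots> = 2 * C" using s0 by simp
    finally show ?thesis .
  qed
  show ?thesis
  proof (rule ccontr)
    define c where "c = \<bar>(V z)\<^sup>2 * \<beta> z\<bar>"
    assume "(V z)\<^sup>2 * \<beta> z \<noteq> 0"
    then have c: "c > 0" by (simp add: c_def)
    \<comment> \<open>A height at which the decay bound for \<open>V\<^sup>2 \<beta>\<close> is already below the constant \<open>c\<close>.\<close>
    define y where "y = (2 * C)\<^sup>2 * D / c"
    have "c = \<bar>V y\<bar>\<^sup>2 * \<bar>\<beta> y\<bar>" unfolding c_def const[of y] by (simp add: abs_mult)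
    also have "\<dots> \<le> (2 * C)\<^sup>2 * (D / sqrt (1 + y\<^sup>2))"
      unfolding \<beta>_def by (intro mult_mono power_mono V D) auto
    finally have "c * sqrt (1 + y\<^sup>2) \<le> (2 * C)\<^sup>2 * D"
      by (simp add: field_simps add_pos_nonneg)
    then have "sqrt (1 + y\<^sup>2) \<le> y" using c by (simp add: y_def field_simps)
    moreover have "y < sqrt (1 + y\<^sup>2)" by (simp add: real_less_rsqrt)
    ultimately show False by simp
  qed
qed

text \<open>Where \<open>\<beta> \<noteq> 0\<close> the function \<open>V\<close> vanishes on a neighbourhood, so its derivative \<open>- u $ 1\<close> vanishes
  too.\<close>

lemma poloidal_zero:
  assumes "\<beta> z \<noteq> 0"
  shows "u (cyl 0 z) $ 1 = 0" "u (cyl 0 z) $ 3 = 0"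
proof -
  have "continuous_on UNIV \<beta>"
    using DERIV_\<beta> by (meson DERIV_isCont continuous_at_imp_continuous_on)
  then have o: "open {z. \<beta> z \<noteq> 0}" by (intro open_Collect_neq) (auto intro: continuous_intros)
  have V0: "V y = 0" if "\<beta> y \<noteq> 0" for y using flux_zero[of y] that by simp
  have "(V has_real_derivative 0) (at z)"
    by (rule has_field_derivative_transform_within_open[OF DERIV_const[of 0] o]) (use assms V0 in auto)
  then show "u (cyl 0 z) $ 1 = 0" using DERIV_unique[OF DERIV_V] by fastforce
  then show "u (cyl 0 z) $ 3 = 0" using V0[OF assms] by (simp add: V_def)
qed

text \<open>The open set on which the flow is a pure swirl; openness allows to differentiate the two
  identities of \<open>u_toroidal\<close>.\<close>

definition \<Omega> :: "(real^3) set" where "\<Omega> = {x. (x $ 1 \<noteq> 0 \<or> x $ 2 \<noteq> 0) \<and> B x \<noteq> 0}"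

lemma \<Omega>_open: "open \<Omega>"
proof -
  let ?S = "{x :: real^3. x $ 1 \<noteq> 0 \<or> x $ 2 \<noteq> 0}"
  have "continuous_on ?S B"
    by (rule continuous_on_subset[OF Ck_on_continuous[OF B.C2]]) auto
  then have "open (B -` (- {0}) \<inter> ?S)"
    using continuous_on_open_vimage[OF open_off_axis] open_Compl[OF closed_singleton] by blast
  moreover have "\<Omega> = B -` (- {0}) \<inter> ?S" by (auto simp: \<Omega>_def)
  ultimately show ?thesis by simp
qed

lemma \<Omega>_nonzero: "x \<in> \<Omega> \<Longrightarrow> x \<noteq> 0"
  by (auto simp: \<Omega>_def)

lemma B_toroidal:
  assumes "x $ 1 \<noteq> 0 \<or> x $ 2 \<noteq> 0"
  shows "B x $ 3 = 0" "x \<bullet> B x = 0"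
proof -
  obtain r t z where r: "r > 0" "x = r *\<^sub>R cyl t z" using off_axis_cyl[OF assms] .
  show "B x $ 3 = 0" "x \<bullet> B x = 0"
    using r by (simp_all add: B.scale_cyl toroidal inner_3)
qed

lemma u_toroidal:
  assumes "x \<in> \<Omega>"
  shows "u x $ 3 = 0" "x \<bullet> u x = 0"
proof -
  obtain r t z where r: "r > 0" "x = r *\<^sub>R cyl t z"
    using off_axis_cyl assms unfolding \<Omega>_def by blast
  have "\<beta> z \<noteq> 0"
  proof
    assume "\<beta> z = 0"
    then have "B (cyl 0 z) = 0" using toroidal by (simp add: vec3_eq_iff \<beta>_def)
    then have "B x = 0" unfolding r(2) B.scale_cyl[OF r(1)] by (simp add: vec3_eq_iff)
    with assms show False by (simp add: \<Omega>_def)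
  qed
  note poloidal_zero[OF this]
  then show "u x $ 3 = 0" "x \<bullet> u x = 0"
    using r by (simp_all add: U.scale_cyl inner_3)
qed

lemma cyl_\<Omega>: "\<beta> z \<noteq> 0 \<Longrightarrow> cyl t z \<in> \<Omega>"
proof -
  assume "\<beta> z \<noteq> 0"
  then have "norm (B (cyl t z)) \<noteq> 0"
    unfolding B.rot[of t z] norm_rotz by (auto simp: \<beta>_def)
  moreover have "cos t \<noteq> 0 \<or> sin t \<noteq> 0" using sin_zero_abs_cos_one[of t] by auto
  ultimately show ?thesis by (simp add: \<Omega>_def)
qed

lemma U_C2_\<Omega>: "Ck_on 2 u \<Omega>"
  by (rule Ck_on_subset[OF U.C2]) (use \<Omega>_nonzero in auto)

text \<open>The momentum equation in radial direction.  The viscous term disappears since \<open>u\<close> is tangential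
  and divergence free, and Euler's identity turns \<open>x \<bullet> \<nabla>p\<close> into \<open>- 2 p\<close>.\<close>

lemma pressure_\<Omega>:
  assumes "x \<in> \<Omega>"
  shows "p x = (B x \<bullet> B x - u x \<bullet> u x) / 2"
proof -
  have x: "x \<noteq> 0" using assms \<Omega>_nonzero by blast
  have "x \<bullet> laplacian u x = 0"
    using tangential_laplacian[OF \<Omega>_open assms U_C2_\<Omega>] u_toroidal(2) div_u[OF x] by simp
  moreover have "x \<bullet> advection u u x = - (u x \<bullet> u x)"
    by (rule tangential_advection[OF \<Omega>_open assms U.diff[OF x]]) (rule u_toroidal)
  moreover have "x \<bullet> advection B B x = - (B x \<bullet> B x)"
    by (rule tangential_advection[OF \<Omega>_open assms B.diff[OF x]])
      (rule B_toroidal, auto simp: \<Omega>_def)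
  moreover have "x \<bullet> gradient p x = - 2 * p x"
    using homogeneous_euler[OF p_hom p_diff[OF x] x]
    by (simp add: gradient_def inner_vec_def)
  moreover have "x \<bullet> (- laplacian u x + advection u u x - advection B B x + gradient p x) = 0"
    unfolding momentum[OF x] by simp
  ultimately show ?thesis by (simp add: inner_simps)
qed

text \<open>The pressure inherits axial symmetry from \<open>pressure_\<Omega>\<close>, since rotations preserve the norms of \<open>u\<close>
  and \<open>B\<close>.\<close>

lemma pressure_axisymmetric:
  assumes "\<beta> z \<noteq> 0"
  shows "pd 2 p (cyl 0 z) = 0"
proof -
  have "p (cyl t z) = p (cyl 0 z)" for t
    using pressure_\<Omega>[OF cyl_\<Omega>[OF assms], of t] pressure_\<Omega>[OF cyl_\<Omega>[OF assms], of 0]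
      norm_rotz[of t "B (cyl 0 z)"] norm_rotz[of t "u (cyl 0 z)"]
    unfolding B.rot[of t z, symmetric] U.rot[of t z, symmetric]
    by (simp flip: power2_norm_eq_inner)
  then have "(\<lambda>t. p (cyl t z)) = (\<lambda>t. p (cyl 0 z))" by (rule ext)
  then have "((\<lambda>t. p (cyl t z)) has_vector_derivative 0) (at 0)" by simp
  with along_cyl_t[OF p_diff[of "cyl 0 z"]] show ?thesis
    by (auto dest: vector_derivative_unique_at)
qed

text \<open>The third component of the momentum equation, in which every term but the pressure vanishes
  identically on \<open>\<Omega>\<close>.\<close>

lemma pressure_vertical:
  assumes "x \<in> \<Omega>"
  shows "pd 3 p x = 0"
proof -
  have x: "x \<noteq> 0" using assms \<Omega>_nonzero by blast
  have "Ck_on 2 B \<Omega>" by (rule Ck_on_subset[OF B.C2]) (use \<Omega>_nonzero in auto)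
  then have B3: "pd i B x $ 3 = 0" for i
    by (rule component_zero[OF \<Omega>_open assms]) (use B_toroidal \<Omega>_def in auto)
  note u3 = component_zero[OF \<Omega>_open assms U_C2_\<Omega> u_toroidal(1)]
  have "(- laplacian u x + advection u u x - advection B B x + gradient p x) $ 3 = 0"
    unfolding momentum[OF x] by simp
  then show ?thesis
    by (simp add: laplacian_def advection_def gradient_def B3 u3)
qed

lemma swirl_ode:
  assumes "\<beta> z \<noteq> 0"
  shows "(1 + z\<^sup>2) * pd 3 (pd 3 u) (cyl 0 z) $ 2 + 3 * z * pd 3 u (cyl 0 z) $ 2 = 0"
proof -
  have "(- laplacian u (cyl 0 z) + advection u u (cyl 0 z) - advection B B (cyl 0 z)
    + gradient p (cyl 0 z)) $ 2 = 0"
    unfolding momentum[OF cyl_nonzero] by simp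
  then show ?thesis
    by (simp add: U.laplacian_swirl advection_def sum_3 gradient_def pressure_axisymmetric[OF assms]
        poloidal_zero[OF assms] toroidal U.pd2 B.pd2)
qed

lemma swirl_difference_const:
  assumes "\<And>z. z \<in> {z1..z2} \<Longrightarrow> \<beta> z \<noteq> 0"
  obtains K where "\<And>z. z \<in> {z1..z2} \<Longrightarrow> (\<beta> z)\<^sup>2 = (u (cyl 0 z) $ 2)\<^sup>2 + K"
proof -
  have "\<exists>c. \<forall>z\<in>{z1..z2}. p (cyl 0 z) = c"
  proof (rule has_field_derivative_zero_constant)
    fix z assume "z \<in> {z1..z2}"
    then show "((\<lambda>z. p (cyl 0 z)) has_real_derivative 0) (at z within {z1..z2})"
      using along_cyl_z[OF p_diff[of "cyl 0 z"]] pressure_vertical[OF cyl_\<Omega>[OF assms]]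
      by (simp add: has_real_derivative_iff_has_vector_derivative has_vector_derivative_at_within)
  qed simp
  then obtain c where c: "\<And>z. z \<in> {z1..z2} \<Longrightarrow> p (cyl 0 z) = c" by blast
  show ?thesis
  proof (rule that[of "2 * c"])
    fix z assume z: "z \<in> {z1..z2}"
    show "(\<beta> z)\<^sup>2 = (u (cyl 0 z) $ 2)\<^sup>2 + 2 * c"
      using pressure_\<Omega>[OF cyl_\<Omega>[OF assms[OF z]], of 0] c[OF z]
      by (simp add: inner_3 toroidal poloidal_zero[OF assms[OF z]] \<beta>_def power2_eq_square)
  qed
qed

text \<open>By \<open>swirl_ode\<close> the quantity \<open>(1 + z\<^sup>2)\<^sup>3\<^sup>/\<^sup>2 w'\<close> is constant, so \<open>w'\<close> has a fixed sign.\<close>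

lemma swirl_monotone:
  assumes "\<And>z. z \<in> {z1..z2} \<Longrightarrow> \<beta> z \<noteq> 0" "z1 \<le> z0" "z0 \<le> z2"
  shows "(u (cyl 0 z1) $ 2 \<le> u (cyl 0 z0) $ 2 \<and> u (cyl 0 z0) $ 2 \<le> u (cyl 0 z2) $ 2)
    \<or> (u (cyl 0 z1) $ 2 \<ge> u (cyl 0 z0) $ 2 \<and> u (cyl 0 z0) $ 2 \<ge> u (cyl 0 z2) $ 2)"
proof -
  let ?w = "\<lambda>z. u (cyl 0 z) $ 2" and ?w' = "\<lambda>z. pd 3 u (cyl 0 z) $ 2"
  have pos: "1 + z\<^sup>2 > 0" for z :: real by (simp add: add_pos_nonneg)
  have "\<exists>c. \<forall>z\<in>{z1..z2}. sqrt (1 + z\<^sup>2) ^ 3 * ?w' z = c"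
  proof (rule has_field_derivative_zero_constant)
    fix z assume "z \<in> {z1..z2}"
    define g where "g = (\<lambda>z. sqrt (1 + z\<^sup>2) :: real)"
    have g: "g z > 0" "(g z)\<^sup>2 = 1 + z\<^sup>2" using pos[of z] by (simp_all add: g_def)
    have "(g has_real_derivative z / g z) (at z)"
      unfolding g_def using pos[of z]
      by (auto intro!: derivative_eq_intros simp: field_simps simp del: real_sqrt_gt_0_iff)
    from DERIV_mult[OF DERIV_power[OF this, of 3] U.DERIV_z_pd3[of 2]]
    have "((\<lambda>z. g z ^ 3 * ?w' z) has_real_derivative
      3 * (z / g z * (g z)\<^sup>2) * ?w' z + pd 3 (pd 3 u) (cyl 0 z) $ 2 * g z ^ 3) (at z)"
      by simp
    moreover have "3 * (z / g z * (g z)\<^sup>2) * ?w' z + pd 3 (pd 3 u) (cyl 0 z) $ 2 * g z ^ 3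
      = g z * ((g z)\<^sup>2 * pd 3 (pd 3 u) (cyl 0 z) $ 2 + 3 * z * ?w' z)"
      using g(1) by (simp add: field_simps power2_eq_square power3_eq_cube)
    moreover have "(g z)\<^sup>2 * pd 3 (pd 3 u) (cyl 0 z) $ 2 + 3 * z * ?w' z = 0"
      unfolding g(2) using swirl_ode[OF assms(1)] \<open>z \<in> {z1..z2}\<close> by simp
    ultimately have "((\<lambda>z. g z ^ 3 * ?w' z) has_real_derivative 0) (at z)" by simp
    then show "((\<lambda>z. sqrt (1 + z\<^sup>2) ^ 3 * ?w' z) has_real_derivative 0) (at z within {z1..z2})"
      unfolding g_def by (rule has_field_derivative_at_within)
  qed simp
  then obtain c where c: "\<And>z. z \<in> {z1..z2} \<Longrightarrow> sqrt (1 + z\<^sup>2) ^ 3 * ?w' z = c" by blast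
  have w': "?w' z = c / sqrt (1 + z\<^sup>2) ^ 3" if "z \<in> {z1..z2}" for z
  proof -
    have "sqrt (1 + z\<^sup>2) ^ 3 \<noteq> 0" using pos[of z] by simp
    with c[OF that] show ?thesis by (metis nonzero_mult_div_cancel_left)
  qed
  have s3: "sqrt (1 + z\<^sup>2) ^ 3 > 0" for z :: real using pos by simp
  show ?thesis
  proof (cases "c \<ge> 0")
    case True
    have sign: "?w' z \<ge> 0" if "z \<in> {z1..z2}" for z
      unfolding w'[OF that] using True s3[of z] by (intro divide_nonneg_pos)
    have "?w z \<le> ?w y" if "z1 \<le> z" "z \<le> y" "y \<le> z2" for z y
    proof (rule DERIV_nonneg_imp_nondecreasing[OF that(2)])
      fix x assume "z \<le> x" "x \<le> y"
      with that have "x \<in> {z1..z2}" by simp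
      from U.DERIV_z[of 2 x] sign[OF this]
      show "\<exists>d. (?w has_real_derivative d) (at x) \<and> 0 \<le> d" by blast
    qed
    with assms show ?thesis by simp
  next
    case False
    have sign: "?w' z \<le> 0" if "z \<in> {z1..z2}" for z
      unfolding w'[OF that] using False s3[of z] by (intro divide_nonpos_pos) auto
    have "?w z \<ge> ?w y" if "z1 \<le> z" "z \<le> y" "y \<le> z2" for z y
    proof (rule DERIV_nonpos_imp_nonincreasing[OF that(2)])
      fix x assume "z \<le> x" "x \<le> y"
      with that have "x \<in> {z1..z2}" by simp
      from U.DERIV_z[of 2 x] sign[OF this]
      show "\<exists>d. (?w has_real_derivative d) (at x) \<and> d \<le> 0" by blast
    qed
    with assms show ?thesis by simp
  qed
qed

text \<open>Otherwise \<open>\<beta>\<^sup>2\<close> has an interval around \<open>z0\<close> on which it stays positive and at whose ends it takes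
  half of its value at \<open>z0\<close>.  There \<open>\<beta>\<^sup>2\<close> and the square of the monotone swirl differ by a constant,
  so \<open>\<beta>\<^sup>2\<close> at \<open>z0\<close> is at most the larger of its two end values.\<close>

lemma \<beta>_zero: "\<beta> z0 = 0"
proof (rule ccontr)
  assume "\<beta> z0 \<noteq> 0"
  define H where "H = (\<lambda>z. (\<beta> z)\<^sup>2)"
  have H0: "H z0 > 0" using \<open>\<beta> z0 \<noteq> 0\<close> by (simp add: H_def)
  obtain D where D: "D \<ge> 0" "\<And>t z k. \<bar>B (cyl t z) $ k\<bar> \<le> D / sqrt (1 + z\<^sup>2)"
    using B.decay by blast
  have small: "H z < H z0 / 2" if z: "\<bar>z\<bar> > 2 * D / \<bar>\<beta> z0\<bar>" for z
  proof -
    have "2 * D < \<bar>\<beta> z0\<bar> * \<bar>z\<bar>" using z \<open>\<beta> z0 \<noteq> 0\<close> by (simp add: field_simps)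
    also have "\<dots> \<le> \<bar>\<beta> z0\<bar> * sqrt (1 + z\<^sup>2)" by (intro mult_left_mono) (simp_all add: real_le_rsqrt)
    finally have "2 * D < \<bar>\<beta> z0\<bar> * sqrt (1 + z\<^sup>2)" .
    moreover have "sqrt (1 + z\<^sup>2) > 0" by (simp add: add_pos_nonneg)
    ultimately have "D / sqrt (1 + z\<^sup>2) < \<bar>\<beta> z0\<bar> / 2" by (simp add: pos_divide_less_eq)
    with D(2)[of 0 z 2] have "\<bar>\<beta> z\<bar> < \<bar>\<beta> z0\<bar> / 2" unfolding \<beta>_def by linarith
    then have "\<bar>\<beta> z\<bar>\<^sup>2 < (\<bar>\<beta> z0\<bar> / 2)\<^sup>2" by (intro power_strict_mono) auto
    also have "\<dots> \<le> \<bar>\<beta> z0\<bar>\<^sup>2 / 2" by (simp add: power_divide)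
    finally show ?thesis by (simp add: H_def)
  qed
  \<comment> \<open>Far enough for \<open>small\<close>, and beyond \<open>z0\<close> on either side.\<close>
  define y where "y = 2 * D / \<bar>\<beta> z0\<bar> + \<bar>z0\<bar> + 1"
  have y0: "2 * D / \<bar>\<beta> z0\<bar> \<ge> 0" using D(1) by simp
  then have y: "2 * D / \<bar>\<beta> z0\<bar> < \<bar>y\<bar>" unfolding y_def by linarith
  have "continuous_on UNIV \<beta>"
    using DERIV_\<beta> by (meson DERIV_isCont continuous_at_imp_continuous_on)
  then have "continuous_on UNIV H" unfolding H_def by (intro continuous_intros)
  then obtain z1 z2 where z: "z1 < z0" "z0 < z2" "H z1 = H z0 / 2" "H z2 = H z0 / 2"
    "\<And>z. z \<in> {z1..z2} \<Longrightarrow> H z0 / 2 \<le> H z"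
  proof (rule level_interval)
    show "- y < z0" "z0 < y" using y0 unfolding y_def by linarith+
    show "H (- y) < H z0 / 2" "H y < H z0 / 2"
      using small[of y] small[of "- y"] y by simp_all
  qed (use H0 in auto)
  have ne: "\<beta> z \<noteq> 0" if "z \<in> {z1..z2}" for z
    using z(5)[OF that] H0 by (auto simp: H_def)
  obtain K where K: "\<And>z. z \<in> {z1..z2} \<Longrightarrow> (\<beta> z)\<^sup>2 = (u (cyl 0 z) $ 2)\<^sup>2 + K"
    using swirl_difference_const[OF ne] by blast
  have "(u (cyl 0 z0) $ 2)\<^sup>2 \<le> (u (cyl 0 z1) $ 2)\<^sup>2 \<or> (u (cyl 0 z0) $ 2)\<^sup>2 \<le> (u (cyl 0 z2) $ 2)\<^sup>2"
    by (rule square_between, rule swirl_monotone) (use ne z(1,2) in auto)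
  then have "H z0 \<le> H z1 \<or> H z0 \<le> H z2"
    using K[of z0] K[of z1] K[of z2] z(1,2) by (auto simp: H_def)
  with z(3,4) H0 show False by simp
qed

text \<open>Homogeneity and symmetry reach the points off the axis, continuity those on the axis.\<close>

theorem magnetic_field_zero:
  assumes "x \<noteq> 0"
  shows "B x = 0"
proof -
  have off: "B x = 0" if off: "x $ 1 \<noteq> 0 \<or> x $ 2 \<noteq> 0" for x
  proof -
    obtain r t z where r: "r > 0" "x = r *\<^sub>R cyl t z" using off_axis_cyl[OF off] .
    have "B (cyl 0 z) = 0" using toroidal \<beta>_zero by (simp add: vec3_eq_iff \<beta>_def)
    then show ?thesis unfolding r(2) B.scale_cyl[OF r(1)] by (simp add: vec3_eq_iff)
  qed
  show ?thesis
  proof (cases "x $ 1 \<noteq> 0 \<or> x $ 2 \<noteq> 0")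
    case False
    \<comment> \<open>A point of the axis is approached horizontally.\<close>
    have "((\<lambda>t. B (x + t *\<^sub>R axis 1 1)) \<longlongrightarrow> B (x + 0 *\<^sub>R axis 1 1)) (at_right 0)"
    proof -
      have "isCont B (x + 0 *\<^sub>R axis 1 1)"
        using differentiable_imp_continuous_within[OF B.diff[OF assms]] by simp
      then show ?thesis
        by (rule isCont_tendsto_compose) (intro tendsto_intros)
    qed
    moreover have "((\<lambda>t. B (x + t *\<^sub>R axis 1 1)) \<longlongrightarrow> 0) (at_right (0::real))"
      by (rule tendsto_eventually)
        (use False in \<open>auto simp: eventually_at_right_less axis_def intro!: off eventually_mono[OF eventually_at_right_less]\<close>)
    ultimately show ?thesis using tendsto_unique[OF trivial_limit_at_right_real] by fastforce
  qed (rule off)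
qed

end

section \<open>Integration and cut-off functions\<close>

text \<open>Dyadic balls of radius \<open>R / 2\<^sup>k\<close> cover the singularity; on the \<open>k\<close>-th shell the function is at
  most \<open>4\<^sup>k\<^sup>+\<^sup>1 / R\<^sup>2\<close>, while the volume of the \<open>k\<close>-th ball is proportional to \<open>R\<^sup>3 / 8\<^sup>k\<close>, so the sum is
  geometric.\<close>

lemma integrable_inverse_square:
  fixes R :: real
  assumes "R > 0"
  shows "integrable lborel (\<lambda>x :: real^3. indicator (ball 0 R) x * (1 / (norm x)\<^sup>2))"
proof (rule integrableI_bounded)
  let ?f = "\<lambda>x :: real^3. indicator (ball 0 R) x * (1 / (norm x)\<^sup>2) :: real"
  let ?t = "\<lambda>k x. ennreal (4 ^ Suc k / R\<^sup>2) * indicator (ball (0 :: real^3) (R / 2 ^ k)) x"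
  have "?f \<in> borel_measurable borel" by (intro borel_measurable_times borel_measurable_divide
      borel_measurable_power borel_measurable_indicator borel_measurable_const borel_measurable_norm) auto
  then show "?f \<in> borel_measurable lborel" by simp
  have le: "ennreal (norm (?f x)) \<le> (\<Sum>k. ?t k x)" for x
  proof (cases "x \<noteq> 0 \<and> norm x < R")
    case True
    then have "\<exists>n. R * (1 / 2) ^ n < norm x"
      using real_arch_pow_inv[of "norm x / R" "1 / 2"] assms by (auto simp: field_simps)
    moreover have "R * (1 / 2) ^ n = R / 2 ^ n" for n by (simp add: power_one_over)
    ultimately have ex: "\<exists>n. R / 2 ^ n \<le> norm x" by (metis less_imp_le)
    \<comment> \<open>The shell of \<open>x\<close>; since \<open>norm x < R\<close>, the least such \<open>n\<close> is positive.\<close>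
    define n where "n = (LEAST n. R / 2 ^ n \<le> norm x)"
    have n: "R / 2 ^ n \<le> norm x" unfolding n_def by (rule LeastI_ex[OF ex])
    with True obtain k where k: "n = Suc k" by (cases n) auto
    have "\<not> R / 2 ^ k \<le> norm x" using not_less_Least[of k "\<lambda>n. R / 2 ^ n \<le> norm x"] k n_def by simp
    then have in_ball: "x \<in> ball 0 (R / 2 ^ k)" by simp
    have "(R / 2 ^ Suc k)\<^sup>2 \<le> (norm x)\<^sup>2" using n k assms by (intro power_mono) auto
    then have "R\<^sup>2 / 4 ^ Suc k \<le> (norm x)\<^sup>2"
      by (simp add: power_divide power_mult_distrib power2_eq_square flip: power_mult_distrib)
    then have "1 / (norm x)\<^sup>2 \<le> 1 / (R\<^sup>2 / 4 ^ Suc k)"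
      using assms True by (intro divide_left_mono) (auto intro!: mult_pos_pos)
    then have "ennreal (norm (?f x)) \<le> ?t k x"
      using True in_ball by (simp add: ennreal_leI)
    also have "\<dots> \<le> (\<Sum>k. ?t k x)"
    proof -
      have "T k \<le> (\<Sum>k. T k)" for T :: "nat \<Rightarrow> ennreal"
        using sum_le_suminf[OF summableI, of "{k}" T] by simp
      then show ?thesis .
    qed
    finally show ?thesis .
  qed (auto simp: indicator_def)
  define c where "c = unit_ball_vol 3 * 4 * R"
  have "(\<integral>\<^sup>+x. ennreal (norm (?f x)) \<partial>lborel) \<le> (\<integral>\<^sup>+x. (\<Sum>k. ?t k x) \<partial>lborel)"
    by (rule nn_integral_mono) (rule le)
  also have "\<dots> = (\<Sum>k. \<integral>\<^sup>+x. ?t k x \<partial>lborel)"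
    by (rule nn_integral_suminf) (intro borel_measurable_times_ennreal borel_measurable_const borel_measurable_indicator, simp)
  also have "\<dots> = (\<Sum>k. ennreal (c * (1 / 2) ^ k))"
  proof (intro suminf_cong)
    fix k
    have "(\<integral>\<^sup>+x. ?t k x \<partial>lborel) = ennreal (4 ^ Suc k / R\<^sup>2) * ennreal (unit_ball_vol 3 * (R / 2 ^ k) ^ 3)"
      using assms by (simp add: nn_integral_cmult_indicator emeasure_ball)
    also have "\<dots> = ennreal (4 ^ Suc k / R\<^sup>2 * (unit_ball_vol 3 * (R / 2 ^ k) ^ 3))"
      by (rule ennreal_mult[symmetric]) (use assms in auto)
    also have "4 ^ Suc k / R\<^sup>2 * (unit_ball_vol 3 * (R / 2 ^ k) ^ 3) = c * (1 / 2) ^ k"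
    proof -
      have "(2 :: real) ^ k * 2 ^ k = 4 ^ k" by (simp flip: power_mult_distrib)
      then show ?thesis
        using assms by (simp add: c_def field_simps power2_eq_square power3_eq_cube)
    qed
    finally show "(\<integral>\<^sup>+x. ?t k x \<partial>lborel) = ennreal (c * (1 / 2) ^ k)" .
  qed
  also have "\<dots> < \<infinity>"
  proof -
    have "summable (\<lambda>k. c * (1 / 2) ^ k :: real)" by (intro summable_mult summable_geometric) simp
    moreover have "c \<ge> 0" using assms by (simp add: c_def)
    ultimately have "(\<Sum>k. ennreal (c * (1 / 2) ^ k)) \<noteq> top" by (intro ennreal_suminf_neq_top) auto
    then show ?thesis by (simp add: less_top)
  qed
  finally show "(\<integral>\<^sup>+x. ennreal (norm (?f x)) \<partial>lborel) < \<infinity>" .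
qed

definition supported_in :: "real \<Rightarrow> (real^3 \<Rightarrow> real) \<Rightarrow> bool" where
  "supported_in R f \<longleftrightarrow> (\<forall>x. R < norm x \<longrightarrow> f x = 0)"

lemma supported_in_pd:
  assumes "supported_in R f"
  shows "supported_in R (pd i f)"
  unfolding supported_in_def
proof (intro allI impI)
  fix x :: "real^3" assume "R < norm x"
  then have "pd i f x = pd i (\<lambda>x. 0) x"
    using assms by (intro pd_cong[of "- cball 0 R"]) (auto simp: supported_in_def)
  then show "pd i f x = 0" by simp
qed

lemma supported_in_bounded:
  assumes "supported_in R f" "continuous_on UNIV f"
  obtains C where "C \<ge> 0" "\<And>x. \<bar>f x\<bar> \<le> C"
proof -
  have "compact (f ` cball 0 R)"
    by (rule compact_continuous_image) (use assms(2) in \<open>auto elim: continuous_on_subset\<close>)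
  then obtain C where C: "C > 0" "\<And>y. y \<in> cball 0 R \<Longrightarrow> norm (f y) \<le> C"
    using bounded_pos[of "f ` cball 0 R"] compact_imp_bounded by (metis image_eqI)
  have "\<bar>f x\<bar> \<le> C" for x
    using C assms(1) by (cases "norm x \<le> R") (auto simp: supported_in_def)
  with C(1) show ?thesis by (intro that[of C]) auto
qed

lemma supported_in_integrable:
  assumes "supported_in R f" "continuous_on UNIV f"
  shows "integrable lborel f"
proof -
  have "integrable lborel (\<lambda>x. indicator (cball 0 R) x *\<^sub>R f x)"
    by (rule borel_integrable_compact) (use assms(2) in \<open>auto elim: continuous_on_subset\<close>)
  moreover have "(\<lambda>x. indicator (cball 0 R) x *\<^sub>R f x) = f"
    using assms(1) by (auto simp: fun_eq_iff supported_in_def indicator_def not_le)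
  ultimately show ?thesis by simp
qed

lemma DERIV_line:
  fixes f :: "real^3 \<Rightarrow> real"
  assumes "f differentiable (at (x + s *\<^sub>R axis j 1))"
  shows "((\<lambda>s. f (x + s *\<^sub>R axis j 1)) has_real_derivative pd j f (x + s *\<^sub>R axis j 1)) (at s)"
proof -
  have "((\<lambda>s. x + s *\<^sub>R axis j 1) has_vector_derivative axis j 1) (at s)"
    by (auto intro!: derivative_eq_intros)
  from has_vector_derivative_pd_chain[OF assms this] show ?thesis
    by (simp add: has_real_derivative_iff_has_vector_derivative axis_def if_distrib[where f = "\<lambda>c. c * _"] cong: if_cong)
qed

text \<open>Difference quotients integrate to zero by translation invariance of the Lebesgue measure, and
  they converge boundedly to the derivative on a fixed ball.\<close>

lemma integral_pd_zero:
  fixes f :: "real^3 \<Rightarrow> real"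
  assumes "Ck_on 1 f UNIV" "supported_in R f"
  shows "has_bochner_integral lborel (pd j f) 0"
proof -
  define e :: "real^3" where "e = axis j 1"
  have e: "norm e = 1" by (simp add: e_def norm_eq_1 inner_axis_axis)
  have diff: "f differentiable (at x)" for x using assms(1) by simp
  have c: "continuous_on UNIV f" by (rule Ck_on_continuous[OF assms(1)])
  have c': "continuous_on UNIV (pd j f)" using assms(1) by simp
  have int: "integrable lborel f" by (rule supported_in_integrable[OF assms(2) c])
  obtain M where M: "M \<ge> 0" "\<And>x. \<bar>pd j f x\<bar> \<le> M"
    using supported_in_bounded[OF supported_in_pd[OF assms(2)] c'] by blast
  define h where "h = (\<lambda>n. 1 / real (Suc n))"
  have h: "0 < h n" "h n \<le> 1" for n by (simp_all add: h_def)
  define Q where "Q = (\<lambda>n x. (f (h n *\<^sub>R e + x) - f x) / h n)"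
  have shift: "integrable lborel (\<lambda>x. f (a + x))" "(\<integral>x. f (a + x) \<partial>lborel) = (\<integral>x. f x \<partial>lborel)" for a
  proof -
    have m: "f \<in> borel_measurable borel" using c by (rule borel_measurable_continuous_onI)
    show "integrable lborel (\<lambda>x. f (a + x))"
      using int integrable_distr_eq[of "(+) a" lborel borel f] m by (simp add: lborel_distr_plus)
    show "(\<integral>x. f (a + x) \<partial>lborel) = (\<integral>x. f x \<partial>lborel)"
      using integral_distr[of "(+) a" lborel borel f] m by (simp add: lborel_distr_plus)
  qed
  have Q0: "(\<integral>x. Q n x \<partial>lborel) = 0" for n
    unfolding Q_def using shift int by simp
  have lim: "(\<lambda>n. Q n x) \<longlonglongrightarrow> pd j f x" for x
  proof -
    have "((\<lambda>s. f (x + s *\<^sub>R e)) has_real_derivative pd j f x) (at 0)"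
      using DERIV_line[OF diff, where x = x and s = 0 and j = j] by (simp add: e_def)
    then have "((\<lambda>s. (f (x + s *\<^sub>R e) - f x) / s) \<longlongrightarrow> pd j f x) (at 0)"
      by (simp add: has_field_derivative_iff)
    moreover have "filterlim h (at 0) sequentially"
      unfolding h_def filterlim_at using LIMSEQ_inverse_real_of_nat
      by (auto simp: divide_inverse)
    ultimately have "((\<lambda>n. (f (x + h n *\<^sub>R e) - f x) / h n) \<longlongrightarrow> pd j f x) sequentially"
      by (rule filterlim_compose)
    then show ?thesis by (simp add: Q_def add.commute)
  qed
  have dom: "norm (Q n x) \<le> indicator (cball 0 (R + 1)) x * M" for n x
  proof (cases "norm x \<le> R + 1")
    case True
    obtain s where "f (x + h n *\<^sub>R e) - f (x + 0 *\<^sub>R e) = (h n - 0) * pd j f (x + s *\<^sub>R e)"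
      using MVT2[of 0 "h n" "\<lambda>s. f (x + s *\<^sub>R e)" "\<lambda>s. pd j f (x + s *\<^sub>R e)"]
        DERIV_line[OF diff] h(1)[of n] unfolding e_def by blast
    then have "Q n x = pd j f (x + s *\<^sub>R e)" using h(1)[of n] by (simp add: Q_def add.commute)
    with M True show ?thesis by simp
  next
    case False
    have "norm x \<le> norm (h n *\<^sub>R e + x) + norm (h n *\<^sub>R e)"
      by (metis add_diff_cancel_left' norm_triangle_ineq4 add.commute norm_minus_commute)
    then have "R < norm (h n *\<^sub>R e + x)" using False h[of n] e by simp
    with False assms(2) show ?thesis by (simp add: Q_def supported_in_def)
  qed
  have w: "integrable lborel (\<lambda>x :: real^3. indicator (cball 0 (R + 1)) x * M)"
    by (intro integrable_mult_left integrable_real_indicator) (use emeasure_bounded_finite[OF bounded_cball[of "0 :: real^3" "R + 1"]] in auto)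
  have m: "pd j f \<in> borel_measurable lborel" "\<And>n. Q n \<in> borel_measurable lborel"
    using c' shift(1) int unfolding Q_def
    by (auto intro!: borel_measurable_continuous_onI borel_measurable_divide borel_measurable_diff
        dest: borel_measurable_integrable)
  note dct = integral_dominated_convergence[where f = "pd j f" and s = Q and w = "\<lambda>x. indicator (cball 0 (R + 1)) x * M",
      OF m w AE_I2 AE_I2]
  have "integrable lborel (pd j f)"
    by (rule integrable_dominated_convergence[where s = Q and w = "\<lambda>x. indicator (cball 0 (R + 1)) x * M",
      OF m w AE_I2 AE_I2]) (use lim dom in auto)
  moreover have "(\<lambda>n. \<integral>x. Q n x \<partial>lborel) \<longlonglongrightarrow> (\<integral>x. pd j f x \<partial>lborel)"
    by (rule dct) (use lim dom in auto)
  then have "(\<integral>x. pd j f x \<partial>lborel) = 0"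
    unfolding Q0 by (simp add: LIMSEQ_const_iff)
  ultimately show ?thesis by (simp add: has_bochner_integral_iff)
qed

lemma DERIV_truncated_power:
  "((\<lambda>t. max 0 t ^ Suc (Suc n)) has_real_derivative real (Suc (Suc n)) * max 0 t ^ Suc n) (at t)"
proof (rule linorder_cases[of t 0])
  assume t: "t < 0"
  have "((\<lambda>t. 0) has_real_derivative real (Suc (Suc n)) * max 0 t ^ Suc n) (at t)"
    using t by simp
  then show ?thesis
    by (rule has_field_derivative_transform_within_open[of _ _ _ "{..<0}"]) (use t in auto)
next
  assume t: "t > 0"
  have "((\<lambda>t. t ^ Suc (Suc n)) has_real_derivative real (Suc (Suc n)) * max 0 t ^ Suc n) (at t)"
    using DERIV_pow[of "Suc (Suc n)" t UNIV] t by (simp add: max_absorb2 del: power_Suc)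
  then show ?thesis
    by (rule has_field_derivative_transform_within_open[of _ _ _ "{0<..}"]) (use t in auto)
next
  assume t: "t = 0"
  have "((\<lambda>s. max 0 s ^ Suc (Suc n) / s) \<longlongrightarrow> 0) (at (0 :: real))"
  proof (rule Lim_null_comparison)
    show "\<forall>\<^sub>F s in at (0 :: real). norm (max 0 s ^ Suc (Suc n) / s) \<le> max 0 s ^ Suc n"
      by (rule always_eventually) (auto simp: max_def divide_simps)
    have "((\<lambda>s :: real. max 0 s ^ Suc n) \<longlongrightarrow> max 0 0 ^ Suc n) (at 0)"
      by (intro tendsto_intros)
    then show "((\<lambda>s :: real. max 0 s ^ Suc n) \<longlongrightarrow> 0) (at 0)" by simp
  qed
  then show ?thesis unfolding t has_field_derivative_iff by simp
qed

text \<open>The profile \<open>k s = 1 - (1 - (s - 1)\<^sub>+\<^sup>3)\<^sub>+\<^sup>3\<close>, where \<open>t\<^sub>+ = max 0 t\<close>.  Cubes of truncations are twice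
  continuously differentiable, which is all the regularity that the second-order weak equations
  require of a cut-off function.\<close>

lemma cutoff_profile:
  obtains k k' k'' :: "real \<Rightarrow> real" and C :: real
  where "\<And>s. (k has_real_derivative k' s) (at s)" "\<And>s. (k' has_real_derivative k'' s) (at s)"
    "continuous_on UNIV k''" "\<And>s. s \<le> 1 \<Longrightarrow> k s = 0" "\<And>s. s \<ge> 2 \<Longrightarrow> k s = 1"
    "\<And>s. s \<ge> 2 \<Longrightarrow> k' s = 0" "\<And>s. s \<ge> 2 \<Longrightarrow> k'' s = 0"
    "C \<ge> 0" "\<And>s. \<bar>k s\<bar> \<le> 1" "\<And>s. s \<ge> 0 \<Longrightarrow> s * \<bar>k' s\<bar> \<le> C" "\<And>s. s \<ge> 0 \<Longrightarrow> s\<^sup>2 * \<bar>k'' s\<bar> \<le> C"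
proof -
  define a where "a = (\<lambda>s :: real. 1 - max 0 (s - 1) ^ 3)"
  define a' where "a' = (\<lambda>s :: real. - 3 * max 0 (s - 1) ^ 2)"
  define a'' where "a'' = (\<lambda>s :: real. - 6 * max 0 (s - 1))"
  define k where "k = (\<lambda>s. 1 - max 0 (a s) ^ 3)"
  define k' where "k' = (\<lambda>s. - 3 * max 0 (a s) ^ 2 * a' s)"
  define k'' where "k'' = (\<lambda>s. - 6 * max 0 (a s) * a' s * a' s - 3 * max 0 (a s) ^ 2 * a'' s)"
  have p3: "((\<lambda>t :: real. max 0 t ^ 3) has_real_derivative 3 * max 0 t ^ 2) (at t)" for t
    using DERIV_truncated_power[of 1 t] by (simp add: numeral_eq_Suc)
  have p2: "((\<lambda>t :: real. max 0 t ^ 2) has_real_derivative 2 * max 0 t) (at t)" for t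
    using DERIV_truncated_power[of 0 t] by (simp add: numeral_eq_Suc)
  have s1: "((\<lambda>s. s - 1) has_real_derivative 1) (at s)" for s :: real
    by (auto intro!: derivative_eq_intros)
  have a: "(a has_real_derivative a' s) (at s)" for s
    unfolding a_def a'_def using DERIV_diff[OF DERIV_const DERIV_chain2[OF p3 s1]] by simp
  have a': "(a' has_real_derivative a'' s) (at s)" for s
    unfolding a'_def a''_def using DERIV_cmult[OF DERIV_chain2[OF p2 s1], of "- 3" s] by simp
  have k: "(k has_real_derivative k' s) (at s)" for s
    unfolding k_def k'_def using DERIV_diff[OF DERIV_const DERIV_chain2[OF p3 a]] by simp
  have k': "(k' has_real_derivative k'' s) (at s)" for s
    unfolding k'_def k''_def
    by (rule DERIV_cong[OF DERIV_mult[OF DERIV_cmult[OF DERIV_chain2[OF p2 a]] a']])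
      (simp add: algebra_simps)
  have ca: "continuous_on UNIV a" "continuous_on UNIV a'" "continuous_on UNIV a''"
    unfolding a_def a'_def a''_def by (intro continuous_intros)+
  have ck'': "continuous_on UNIV k''" unfolding k''_def by (intro continuous_intros ca)
  have ck': "continuous_on UNIV k'" unfolding k'_def by (intro continuous_intros ca)
  have lo: "a s = 1" "a' s = 0" "a'' s = 0" if "s \<le> 1" for s
    using that by (simp_all add: a_def a'_def a''_def)
  have hi: "a s \<le> 0" if "s \<ge> 2" for s
    using one_le_power[of "s - 1" 3] that by (simp add: a_def)
  have a1: "a s \<le> 1" for s by (simp add: a_def)
  have bound: "\<exists>C. \<forall>s\<ge>0. s ^ m * \<bar>f s\<bar> \<le> C"
    if c: "continuous_on UNIV f" and l: "\<And>s. s \<le> 1 \<Longrightarrow> f s = 0" and h: "\<And>s. s \<ge> 2 \<Longrightarrow> f s = 0"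
    for m and f :: "real \<Rightarrow> real"
  proof -
    have "compact ((\<lambda>s. s ^ m * \<bar>f s\<bar>) ` {1..2})"
      by (intro compact_continuous_image continuous_intros continuous_on_subset[OF c]) auto
    then obtain C where C: "C > 0" "\<And>s. s \<in> {1..2} \<Longrightarrow> norm (s ^ m * \<bar>f s\<bar>) \<le> C"
      using bounded_pos compact_imp_bounded by (metis (mono_tags, lifting) image_eqI)
    have "s ^ m * \<bar>f s\<bar> \<le> C" for s
    proof (cases "s \<in> {1..2}")
      case True
      then show ?thesis using C(2) by fastforce
    next
      case False
      then have "f s = 0" using l h by force
      with C(1) show ?thesis by simp
    qed
    then show ?thesis by blast
  qed
  have k_lo: "k s = 0" "k' s = 0" "k'' s = 0" if "s \<le> 1" for s
    using lo[OF that] by (simp_all add: k_def k'_def k''_def)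
  have k_hi: "k s = 1" "k' s = 0" "k'' s = 0" if "s \<ge> 2" for s
    using hi[OF that] by (simp_all add: k_def k'_def k''_def)
  obtain C1 where C1: "\<And>s. s \<ge> 0 \<Longrightarrow> s ^ 1 * \<bar>k' s\<bar> \<le> C1"
    using bound[OF ck' k_lo(2) k_hi(2), of 1] by blast
  obtain C2 where C2: "\<And>s. s \<ge> 0 \<Longrightarrow> s ^ 2 * \<bar>k'' s\<bar> \<le> C2"
    using bound[OF ck'' k_lo(3) k_hi(3), of 2] by blast
  show ?thesis
  proof (rule that[OF k k' ck'' k_lo(1) k_hi])
    show "\<bar>k s\<bar> \<le> 1" for s
      using power_le_one[of "max 0 (a s)" 3] a1[of s] by (simp add: k_def)
    show "0 \<le> \<bar>C1\<bar> + \<bar>C2\<bar>" by simp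
    show "s * \<bar>k' s\<bar> \<le> \<bar>C1\<bar> + \<bar>C2\<bar>" if "s \<ge> 0" for s using C1[OF that] by simp
    show "s\<^sup>2 * \<bar>k'' s\<bar> \<le> \<bar>C1\<bar> + \<bar>C2\<bar>" if "s \<ge> 0" for s using C2[OF that] by simp
  qed
qed

lemma pd_radial:
  assumes "\<And>s. (k has_real_derivative k' s) (at s)"
  shows "pd i (\<lambda>x. k (c * (x \<bullet> x))) x = k' (c * (x \<bullet> x)) * (2 * c * x $ i)"
    and "(\<lambda>x. k (c * (x \<bullet> x))) differentiable (at x)"
proof -
  have "((\<lambda>x :: real^3. c * (x \<bullet> x)) has_derivative (\<lambda>v. 2 * c * (x \<bullet> v))) (at x)"
    by (auto intro!: derivative_eq_intros simp: inner_commute)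
  from has_derivative_compose[OF this, of k "(*) (k' (c * (x \<bullet> x)))"]
  have D: "((\<lambda>x. k (c * (x \<bullet> x))) has_derivative (\<lambda>v. k' (c * (x \<bullet> x)) * (2 * c * (x \<bullet> v)))) (at x)"
    using assms by (simp add: has_field_derivative_def)
  from pd_eqI[OF D, of i] show "pd i (\<lambda>x. k (c * (x \<bullet> x))) x = k' (c * (x \<bullet> x)) * (2 * c * x $ i)"
    by (simp add: inner_axis)
  from D show "(\<lambda>x. k (c * (x \<bullet> x))) differentiable (at x)" by (auto simp: differentiable_def)
qed

lemma Ck_on_radial:
  assumes "\<And>s. (k has_real_derivative k' s) (at s)" "\<And>s. (k' has_real_derivative k'' s) (at s)"
    "continuous_on UNIV k''"
  shows "Ck_on 2 (\<lambda>x. k (c * (x \<bullet> x))) UNIV"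
proof -
  have 1: "Ck_on n (pd i (\<lambda>x. f (c * (x \<bullet> x)))) UNIV"
    if "\<And>s. (f has_real_derivative f' s) (at s)" "Ck_on n (\<lambda>x. f' (c * (x \<bullet> x))) UNIV" for f f' n i
  proof -
    have "Ck_on n (\<lambda>x. f' (c * (x \<bullet> x)) * (2 * c * x $ i)) UNIV"
      by (intro Ck_on_mult that(2) Ck_on_const Ck_on_nth Ck_on_id open_UNIV)
    moreover have "pd i (\<lambda>x. f (c * (x \<bullet> x))) = (\<lambda>x. f' (c * (x \<bullet> x)) * (2 * c * x $ i))"
      by (rule ext) (rule pd_radial(1)[OF that(1)])
    ultimately show ?thesis by simp
  qed
  have "Ck_on 0 (\<lambda>x. k'' (c * (x \<bullet> x))) UNIV"
    using continuous_on_compose2[OF assms(3), of UNIV "\<lambda>x. c * (x \<bullet> x)"]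
    by (simp add: continuous_intros)
  then have "Ck_on 1 (\<lambda>x. k' (c * (x \<bullet> x))) UNIV"
    using 1[OF assms(2), of 0] pd_radial(2)[OF assms(2)] by simp
  then show ?thesis
    using 1[OF assms(1), of 1] pd_radial(2)[OF assms(1)] unfolding numeral_2_eq_2 by simp
qed

lemma C2_D:
  assumes "Ck_on 2 f UNIV"
  shows "f differentiable (at x)" "pd i f differentiable (at x)" "continuous_on UNIV f"
    "continuous_on UNIV (pd i f)" "continuous_on UNIV (laplacian f)"
proof -
  show "f differentiable (at x)" "pd i f differentiable (at x)"
    using assms by (simp_all add: numeral_2_eq_2)
  show "continuous_on UNIV f" using Ck_on_continuous[OF assms] .
  have "Ck_on 1 (pd i f) UNIV" using assms by (simp add: numeral_2_eq_2)
  then show "continuous_on UNIV (pd i f)" by (rule Ck_on_continuous)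
  have "continuous_on UNIV (pd i (pd i f))" for i using assms by (simp add: numeral_2_eq_2)
  then show "continuous_on UNIV (laplacian f)"
    unfolding laplacian_def[abs_def] by (intro continuous_intros)
qed

lemma pd_mult_real:
  fixes f g :: "real^3 \<Rightarrow> real"
  assumes "Ck_on 2 f UNIV" "Ck_on 2 g UNIV"
  shows "pd j (\<lambda>x. f x * g x) = (\<lambda>x. f x * pd j g x + pd j f x * g x)"
  by (rule ext) (rule pd_mult[OF C2_D(1)[OF assms(1)] C2_D(1)[OF assms(2)]])

lemma laplacian_mult:
  fixes f g :: "real^3 \<Rightarrow> real"
  assumes "Ck_on 2 f UNIV" "Ck_on 2 g UNIV"
  shows "laplacian (\<lambda>x. f x * g x) x
    = f x * laplacian g x + 2 * (\<Sum>j\<in>UNIV. pd j f x * pd j g x) + laplacian f x * g x"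
proof -
  note f = C2_D(1,2)[OF assms(1)] and g = C2_D(1,2)[OF assms(2)]
  have "pd j (pd j (\<lambda>x. f x * g x)) x
    = f x * pd j (pd j g) x + 2 * (pd j f x * pd j g x) + pd j (pd j f) x * g x" for j
    unfolding pd_mult_real[OF assms]
    by (simp add: f g pd_add pd_mult pd_bilinear(2)[OF bounded_bilinear_mult])
  then show ?thesis
    by (simp add: laplacian_def sum.distrib sum_distrib_left sum_distrib_right)
qed

text \<open>The functions \<open>g n x = k ((n + 1) \<bar>x\<bar>\<^sup>2)\<close> vanish near the origin and tend to \<open>1\<close> elsewhere.  The point
  is that the bounds on the derivatives are scale invariant, hence uniform in \<open>n\<close>.\<close>

lemma cutoff_family:
  obtains g :: "nat \<Rightarrow> real^3 \<Rightarrow> real" and L :: real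
  where "\<And>n. Ck_on 2 (g n) UNIV"
    "\<And>n. \<exists>r>0. \<forall>x. norm x < r \<longrightarrow> g n x = 0"
    "\<And>n x. 2 \<le> norm x \<Longrightarrow> g n x = 1"
    "\<And>x. x \<noteq> 0 \<Longrightarrow> \<forall>\<^sub>F n in sequentially. g n x = 1 \<and> (\<forall>j. pd j (g n) x = 0) \<and> laplacian (g n) x = 0"
    "L \<ge> 0" "\<And>n x. \<bar>g n x\<bar> \<le> 1"
    "\<And>n j x. x \<noteq> 0 \<Longrightarrow> \<bar>pd j (g n) x\<bar> \<le> L / norm x"
    "\<And>n x. x \<noteq> 0 \<Longrightarrow> \<bar>laplacian (g n) x\<bar> \<le> L / (norm x)\<^sup>2"
proof -
  obtain k k' k'' :: "real \<Rightarrow> real" and C :: real where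
    k: "\<And>s. (k has_real_derivative k' s) (at s)" "\<And>s. (k' has_real_derivative k'' s) (at s)"
    "continuous_on UNIV k''" "\<And>s. s \<le> 1 \<Longrightarrow> k s = 0" "\<And>s. s \<ge> 2 \<Longrightarrow> k s = 1"
    "\<And>s. s \<ge> 2 \<Longrightarrow> k' s = 0" "\<And>s. s \<ge> 2 \<Longrightarrow> k'' s = 0"
    and C: "C \<ge> 0" "\<And>s. \<bar>k s\<bar> \<le> 1" "\<And>s. s \<ge> 0 \<Longrightarrow> s * \<bar>k' s\<bar> \<le> C" "\<And>s. s \<ge> 0 \<Longrightarrow> s\<^sup>2 * \<bar>k'' s\<bar> \<le> C"
    by (rule cutoff_profile) (rule that; assumption)
  define c where "c = (\<lambda>n. real (Suc n))"
  have c: "c n \<ge> 1" "c n > 0" for n by (simp_all add: c_def)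
  define g where "g = (\<lambda>n (x :: real^3). k (c n * (x \<bullet> x)))"
  have g1: "pd j (g n) = (\<lambda>x. k' (c n * (x \<bullet> x)) * (2 * c n * x $ j))" for n j
    unfolding g_def by (rule ext) (rule pd_radial(1)[OF k(1)])
  have xj: "pd j (\<lambda>x :: real^3. 2 * c n * x $ j) x = 2 * c n" for n j x
    using pd_linear(1)[OF bounded_linear_compose[OF bounded_linear_mult_right bounded_linear_vec_nth],
        of "\<lambda>x. x" x j "2 * c n" j]
    by (simp add: pd_id axis_def)
  have g2: "pd j (pd j (g n)) x
    = k'' (c n * (x \<bullet> x)) * (2 * c n * x $ j)\<^sup>2 + k' (c n * (x \<bullet> x)) * (2 * c n)" for n j x
  proof -
    have d: "(\<lambda>x :: real^3. 2 * c n * x $ j) differentiable (at x)"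
      using pd_linear(2)[OF bounded_linear_compose[OF bounded_linear_mult_right bounded_linear_vec_nth],
          of "\<lambda>x. x" x "2 * c n" j] by simp
    show ?thesis
      unfolding g1 using pd_mult[OF pd_radial(2)[OF k(2)] d, of j "c n"]
      by (simp add: xj pd_radial(1)[OF k(2)] power2_eq_square)
  qed
  have g2_sum: "laplacian (g n) x
    = k'' (c n * (x \<bullet> x)) * (4 * (c n)\<^sup>2 * (x \<bullet> x)) + 6 * c n * k' (c n * (x \<bullet> x))" for n x
    unfolding laplacian_def g2 by (simp add: sum_3 inner_vec_def algebra_simps power2_eq_square)
  have nn: "x \<bullet> x = (norm x)\<^sup>2" for x :: "real^3" by (simp add: power2_norm_eq_inner)
  show ?thesis
  proof (rule that[of g "10 * C"])
    show "Ck_on 2 (g n) UNIV" for n unfolding g_def by (rule Ck_on_radial[OF k(1-3)])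
    show "\<exists>r>0. \<forall>x. norm x < r \<longrightarrow> g n x = 0" for n
    proof (intro exI[of _ "1 / c n"] conjI allI impI)
      fix x :: "real^3" assume x: "norm x < 1 / c n"
      have "c n * (x \<bullet> x) = (c n * norm x) * norm x" by (simp add: nn power2_eq_square)
      also have "\<dots> \<le> 1 * 1"
      proof (rule mult_mono)
        show "c n * norm x \<le> 1" using x c(2)[of n] by (simp add: field_simps)
        have "norm x \<le> c n * norm x" using c(1)[of n] by (simp add: mult_le_cancel_right1)
        then show "norm x \<le> 1" using \<open>c n * norm x \<le> 1\<close> by simp
      qed (use c(2)[of n] in auto)
      finally show "g n x = 0" by (simp add: g_def k(4))
    qed (use c(2)[of n] in simp)
    show "g n x = 1" if "2 \<le> norm x" for n x
    proof -
      have "1 * 2\<^sup>2 \<le> c n * (norm x)\<^sup>2" by (intro mult_mono power_mono c that) (use c(2)[of n] in auto)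
      then show ?thesis by (simp add: g_def nn k(5))
    qed
    show "\<forall>\<^sub>F n in sequentially. g n x = 1 \<and> (\<forall>j. pd j (g n) x = 0) \<and> laplacian (g n) x = 0"
      if "x \<noteq> 0" for x
    proof -
      have x: "x \<bullet> x > 0" using that by simp
      obtain N where N: "2 / (x \<bullet> x) < real N" using reals_Archimedean2 by blast
      show ?thesis
      proof (rule eventually_sequentiallyI[of N])
        fix n assume "N \<le> n"
        then have "2 / (x \<bullet> x) \<le> c n" using N by (simp add: c_def)
        then have "2 \<le> c n * (x \<bullet> x)" using x by (simp add: pos_divide_le_eq)
        then show "g n x = 1 \<and> (\<forall>j. pd j (g n) x = 0) \<and> laplacian (g n) x = 0"
          by (simp add: g1 g2_sum k) (simp add: g_def k)
      qed
    qed
    show "10 * C \<ge> 0" using C(1) by simp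
    show "\<bar>g n x\<bar> \<le> 1" for n x by (simp add: g_def C)
    show "\<bar>pd j (g n) x\<bar> \<le> 10 * C / norm x" if "x \<noteq> 0" for n j x
    proof -
      define s where "s = c n * (x \<bullet> x)"
      have s: "s \<ge> 0" "s = c n * (norm x * norm x)" using c(2)[of n] by (simp_all add: s_def nn power2_eq_square)
      have "\<bar>pd j (g n) x\<bar> * norm x = \<bar>k' s\<bar> * (2 * c n * \<bar>x $ j\<bar>) * norm x"
        using c(2)[of n] by (simp add: g1 abs_mult s_def)
      also have "\<dots> \<le> \<bar>k' s\<bar> * (2 * c n * norm x) * norm x"
        using c(2)[of n] by (intro mult_right_mono mult_left_mono component_le_norm_cart) auto
      also have "\<dots> = 2 * (s * \<bar>k' s\<bar>)" by (simp add: s(2))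
      also have "\<dots> \<le> 10 * C" using C(3)[OF s(1)] C(1) by simp
      finally show ?thesis using that by (simp add: field_simps)
    qed
    show "\<bar>laplacian (g n) x\<bar> \<le> 10 * C / (norm x)\<^sup>2" if "x \<noteq> 0" for n x
    proof -
      define s where "s = c n * (x \<bullet> x)"
      have s: "s \<ge> 0" using c(2)[of n] by (simp add: s_def)
      have "laplacian (g n) x * (norm x)\<^sup>2 = 4 * (s\<^sup>2 * k'' s) + 6 * (s * k' s)"
        unfolding g2_sum by (simp add: s_def nn algebra_simps power2_eq_square)
      then have "\<bar>laplacian (g n) x\<bar> * (norm x)\<^sup>2 \<le> 4 * \<bar>s\<^sup>2 * k'' s\<bar> + 6 * \<bar>s * k' s\<bar>"
        using abs_triangle_ineq[of "4 * (s\<^sup>2 * k'' s)" "6 * (s * k' s)"]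
        by (metis abs_mult abs_numeral abs_power2)
      also have "\<dots> \<le> 4 * C + 6 * C"
        using C(3,4)[OF s] s by (simp add: abs_mult)
      finally show ?thesis using that by (simp add: field_simps)
    qed
  qed
qed

section \<open>Linear differential operators with a source at the origin\<close>

text \<open>The common form of the integrands in the weak momentum and continuity equations.\<close>

definition weak_op :: "(real^3 \<Rightarrow> real) \<Rightarrow> (3 \<Rightarrow> real^3 \<Rightarrow> real) \<Rightarrow> (real^3 \<Rightarrow> real) \<Rightarrow> real^3 \<Rightarrow> real" where
  "weak_op a b \<psi> x = a x * laplacian \<psi> x + (\<Sum>j\<in>UNIV. b j x * pd j \<psi> x)"

lemma weak_op_supported:
  assumes "supported_in R \<psi>" "R < norm x"
  shows "weak_op a b \<psi> x = 0"
  using supported_in_pd[OF assms(1)] supported_in_pd[OF supported_in_pd[OF assms(1)]] assms(2)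
  by (simp add: weak_op_def laplacian_def supported_in_def)

lemma supported_in_mono: "supported_in R f \<Longrightarrow> R \<le> S \<Longrightarrow> supported_in S f"
  by (auto simp: supported_in_def)

lemma C2_bounded:
  assumes "Ck_on 2 \<psi> UNIV" "supported_in R \<psi>"
  obtains M where "M \<ge> 0" "\<And>x. \<bar>\<psi> x\<bar> \<le> M" "\<And>j x. \<bar>pd j \<psi> x\<bar> \<le> M" "\<And>x. \<bar>laplacian \<psi> x\<bar> \<le> M"
proof -
  have s: "supported_in R (laplacian \<psi>)"
    using supported_in_pd[OF supported_in_pd[OF assms(2)]]
    by (simp add: laplacian_def supported_in_def)
  obtain M0 where M0: "M0 \<ge> 0" "\<And>x. \<bar>\<psi> x\<bar> \<le> M0"
    using supported_in_bounded[OF assms(2) C2_D(3)[OF assms(1)]] by blast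
  have "\<exists>M. M \<ge> 0 \<and> (\<forall>x. \<bar>pd j \<psi> x\<bar> \<le> M)" for j
    using supported_in_bounded[OF supported_in_pd[OF assms(2)] C2_D(4)[OF assms(1)]] by metis
  then obtain M1 where M1: "\<And>j. M1 j \<ge> 0" "\<And>j x. \<bar>pd j \<psi> x\<bar> \<le> M1 j" by metis
  obtain M2 where M2: "M2 \<ge> 0" "\<And>x. \<bar>laplacian \<psi> x\<bar> \<le> M2"
    using supported_in_bounded[OF s C2_D(5)[OF assms(1)]] by blast
  have S: "M1 j \<le> (\<Sum>j\<in>UNIV. M1 j)" for j using M1(1) by (intro member_le_sum) auto
  have S0: "(\<Sum>j\<in>UNIV. M1 j) \<ge> 0" using M1(1) by (intro sum_nonneg) auto
  show ?thesis
  proof (rule that[of "M0 + (\<Sum>j\<in>UNIV. M1 j) + M2"])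
    fix x
    show "\<bar>\<psi> x\<bar> \<le> M0 + (\<Sum>j\<in>UNIV. M1 j) + M2" using M0(2)[of x] S0 M2(1) by linarith
    show "\<bar>pd j \<psi> x\<bar> \<le> M0 + (\<Sum>j\<in>UNIV. M1 j) + M2" for j
      using M1(2)[of j x] S[of j] M0(1) M2(1) by linarith
    show "\<bar>laplacian \<psi> x\<bar> \<le> M0 + (\<Sum>j\<in>UNIV. M1 j) + M2" using M2(2)[of x] S0 M0(1) by linarith
  qed (use M0(1) S0 M2(1) in linarith)
qed

lemma weak_op_measurable:
  assumes "continuous_on (- {0}) a" "\<And>j. continuous_on (- {0}) (b j)" "Ck_on 2 \<psi> UNIV"
  shows "weak_op a b \<psi> \<in> borel_measurable lborel"
proof -
  have c: "continuous_on (- {0}) (laplacian \<psi>)" "\<And>j. continuous_on (- {0}) (pd j \<psi>)"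
    using C2_D[OF assms(3)] continuous_on_subset by blast+
  have "continuous_on (- {0}) (weak_op a b \<psi>)"
    unfolding weak_op_def[abs_def] by (intro continuous_intros assms c)
  then have "weak_op a b \<psi> \<in> borel_measurable borel"
    by (intro borel_measurable_continuous_countable_exceptions[of "{0}"]) auto
  then show ?thesis by simp
qed

lemma dominating_function:
  assumes "R > 0"
  shows "integrable lborel (\<lambda>x :: real^3. indicator (ball 0 (R + 1)) x * (1 / (norm x)\<^sup>2) * D)"
  by (intro integrable_mult_left integrable_inverse_square) (use assms in simp)

lemma AE_nonzero: "AE x in lborel. (x :: real^3) \<noteq> 0"
  by (rule AE_lborel_singleton)

text \<open>Test with \<open>\<psi> g\<close>, where \<open>g\<close> runs through the cut-off family.  The two bounds are what the product
  rule requires for the integrands to stay below a multiple of \<open>1 / \<bar>x\<bar>\<^sup>2\<close>.  They can be met in two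
  ways: by the vanishing of \<open>\<psi>\<close> at the origin, or by less singular coefficients.\<close>

lemma weak_op_vanishing_limit:
  assumes R: "R > 0" and D: "D \<ge> 0" and a: "continuous_on (- {0}) a" and b: "\<And>j. continuous_on (- {0}) (b j)"
    and \<psi>: "Ck_on 2 \<psi> UNIV" "supported_in R \<psi>"
    and a_le: "\<And>x. x \<noteq> 0 \<Longrightarrow> norm x \<le> R \<Longrightarrow>
      \<bar>a x\<bar> * (1 + 1 / norm x + \<bar>\<psi> x\<bar> / (norm x)\<^sup>2) \<le> D / (norm x)\<^sup>2"
    and b_le: "\<And>j x. x \<noteq> 0 \<Longrightarrow> norm x \<le> R \<Longrightarrow> \<bar>b j x\<bar> * (1 + \<bar>\<psi> x\<bar> / norm x) \<le> D / (norm x)\<^sup>2"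
    and away: "\<And>\<phi> r. Ck_on 2 \<phi> UNIV \<Longrightarrow> supported_in R \<phi> \<Longrightarrow> r > 0 \<Longrightarrow>
      (\<And>x. norm x < r \<Longrightarrow> \<phi> x = 0) \<Longrightarrow> integral\<^sup>L lborel (weak_op a b \<phi>) = 0"
  shows "has_bochner_integral lborel (weak_op a b \<psi>) 0"
proof -
  obtain g :: "nat \<Rightarrow> real^3 \<Rightarrow> real" and L :: real where
    g: "\<And>n. Ck_on 2 (g n) UNIV" "\<And>n. \<exists>r>0. \<forall>x. norm x < r \<longrightarrow> g n x = 0"
    "\<And>x. x \<noteq> 0 \<Longrightarrow> \<forall>\<^sub>F n in sequentially. g n x = 1 \<and> (\<forall>j. pd j (g n) x = 0) \<and> laplacian (g n) x = 0"
    and L: "L \<ge> 0" "\<And>n x. \<bar>g n x\<bar> \<le> 1"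
    "\<And>n j x. x \<noteq> 0 \<Longrightarrow> \<bar>pd j (g n) x\<bar> \<le> L / norm x"
    "\<And>n x. x \<noteq> 0 \<Longrightarrow> \<bar>laplacian (g n) x\<bar> \<le> L / (norm x)\<^sup>2"
    by (rule cutoff_family) (rule that; assumption)
  obtain M where M: "M \<ge> 0" "\<And>x. \<bar>\<psi> x\<bar> \<le> M" "\<And>j x. \<bar>pd j \<psi> x\<bar> \<le> M" "\<And>x. \<bar>laplacian \<psi> x\<bar> \<le> M"
    using C2_bounded[OF \<psi>] by blast
  define \<phi> where "\<phi> = (\<lambda>n x. \<psi> x * g n x)"
  have \<phi>: "Ck_on 2 (\<phi> n) UNIV" "supported_in R (\<phi> n)" for n
    using \<psi>(2) Ck_on_mult[OF open_UNIV \<psi>(1) g(1)] by (auto simp: \<phi>_def supported_in_def)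
  have int0: "integral\<^sup>L lborel (weak_op a b (\<phi> n)) = 0" for n
    using g(2)[of n] away[OF \<phi>[of n]] by (auto simp: \<phi>_def)
  have expand: "weak_op a b (\<phi> n) x
    = a x * (\<psi> x * laplacian (g n) x + 2 * (\<Sum>j\<in>UNIV. pd j \<psi> x * pd j (g n) x) + laplacian \<psi> x * g n x)
      + (\<Sum>j\<in>UNIV. b j x * (\<psi> x * pd j (g n) x + pd j \<psi> x * g n x))" for n x
    unfolding weak_op_def \<phi>_def laplacian_mult[OF \<psi>(1) g(1)] pd_mult_real[OF \<psi>(1) g(1)] ..
  \<comment> \<open>At each point other than the origin the sequence is eventually constant.\<close>
  have lim: "(\<lambda>n. weak_op a b (\<phi> n) x) \<longlonglongrightarrow> weak_op a b \<psi> x" if "x \<noteq> 0" for x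
    by (rule tendsto_eventually, rule eventually_mono[OF g(3)[OF that]])
      (simp add: expand, simp add: weak_op_def)
  define N where "N = M + 6 * M * L + L"
  have N: "M \<le> N" "6 * M * L \<le> N" "L \<le> N" and N0: "0 \<le> N"
    using M(1) L(1) by (simp_all add: N_def)
  have dom: "norm (weak_op a b (\<phi> n) x) \<le> indicator (ball 0 (R + 1)) x * (1 / (norm x)\<^sup>2) * (4 * N * D)"
    if x: "x \<noteq> 0" for n x
  proof (cases "norm x \<le> R")
    case False
    then show ?thesis using weak_op_supported[OF \<phi>(2)[of n], of x] D N0 by simp
  next
    case True
    have n0: "norm x > 0" using x by simp
    have "\<bar>\<psi> x * laplacian (g n) x\<bar> \<le> \<bar>\<psi> x\<bar> * (L / (norm x)\<^sup>2)"
      unfolding abs_mult by (intro mult_left_mono L x) simp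
    moreover have "\<bar>\<Sum>j\<in>UNIV. pd j \<psi> x * pd j (g n) x\<bar> \<le> (\<Sum>j\<in>(UNIV :: 3 set). M * (L / norm x))"
      unfolding abs_mult[symmetric]
      by (rule order_trans[OF sum_abs sum_mono]) (unfold abs_mult, intro mult_mono M L x abs_ge_zero)
    moreover have "\<bar>laplacian \<psi> x * g n x\<bar> \<le> M * 1"
      unfolding abs_mult by (intro mult_mono M L abs_ge_zero)
    ultimately have "\<bar>\<psi> x * laplacian (g n) x + 2 * (\<Sum>j\<in>UNIV. pd j \<psi> x * pd j (g n) x) + laplacian \<psi> x * g n x\<bar>
      \<le> \<bar>\<psi> x\<bar> * (L / (norm x)\<^sup>2) + 6 * (M * (L / norm x)) + M" by simp
    also have "\<dots> = L * (\<bar>\<psi> x\<bar> / (norm x)\<^sup>2) + (6 * M * L) * (1 / norm x) + M * 1" by (simp add: mult_ac)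
    also have "\<dots> \<le> N * (\<bar>\<psi> x\<bar> / (norm x)\<^sup>2) + N * (1 / norm x) + N * 1"
      by (intro add_mono mult_right_mono N) auto
    finally have e1: "\<bar>\<psi> x * laplacian (g n) x + 2 * (\<Sum>j\<in>UNIV. pd j \<psi> x * pd j (g n) x) + laplacian \<psi> x * g n x\<bar>
      \<le> N * (1 + 1 / norm x + \<bar>\<psi> x\<bar> / (norm x)\<^sup>2)" (is "\<bar>?E1\<bar> \<le> _") by (simp add: algebra_simps)
    have "\<bar>a x * ?E1\<bar> \<le> \<bar>a x\<bar> * (N * (1 + 1 / norm x + \<bar>\<psi> x\<bar> / (norm x)\<^sup>2))"
      unfolding abs_mult by (intro mult_left_mono e1) simp
    also have "\<dots> = N * (\<bar>a x\<bar> * (1 + 1 / norm x + \<bar>\<psi> x\<bar> / (norm x)\<^sup>2))" by simp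
    also have "\<dots> \<le> N * (D / (norm x)\<^sup>2)" by (intro mult_left_mono a_le x True N0)
    finally have A: "\<bar>a x * ?E1\<bar> \<le> N * (D / (norm x)\<^sup>2)" .
    have B: "\<bar>b j x * (\<psi> x * pd j (g n) x + pd j \<psi> x * g n x)\<bar> \<le> N * (D / (norm x)\<^sup>2)" for j
    proof -
      have "\<bar>\<psi> x * pd j (g n) x\<bar> \<le> \<bar>\<psi> x\<bar> * (L / norm x)"
        unfolding abs_mult by (intro mult_left_mono L x) simp
      moreover have "\<bar>pd j \<psi> x * g n x\<bar> \<le> M * 1"
        unfolding abs_mult by (intro mult_mono M L abs_ge_zero)
      moreover have "\<bar>\<psi> x\<bar> * (L / norm x) = L * (\<bar>\<psi> x\<bar> / norm x)" by simp
      ultimately have "\<bar>\<psi> x * pd j (g n) x + pd j \<psi> x * g n x\<bar> \<le> L * (\<bar>\<psi> x\<bar> / norm x) + M * 1"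
        by linarith
      also have "\<dots> \<le> N * (\<bar>\<psi> x\<bar> / norm x) + N * 1"
        by (intro add_mono mult_right_mono N) auto
      finally have e2: "\<bar>\<psi> x * pd j (g n) x + pd j \<psi> x * g n x\<bar> \<le> N * (1 + \<bar>\<psi> x\<bar> / norm x)"
        by (simp add: algebra_simps)
      have "\<bar>b j x * (\<psi> x * pd j (g n) x + pd j \<psi> x * g n x)\<bar> \<le> \<bar>b j x\<bar> * (N * (1 + \<bar>\<psi> x\<bar> / norm x))"
        unfolding abs_mult by (intro mult_left_mono e2) simp
      also have "\<dots> = N * (\<bar>b j x\<bar> * (1 + \<bar>\<psi> x\<bar> / norm x))" by simp
      also have "\<dots> \<le> N * (D / (norm x)\<^sup>2)" by (intro mult_left_mono b_le x True N0)
      finally show ?thesis .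
    qed
    have "\<bar>\<Sum>j\<in>UNIV. b j x * (\<psi> x * pd j (g n) x + pd j \<psi> x * g n x)\<bar> \<le> (\<Sum>j\<in>(UNIV :: 3 set). N * (D / (norm x)\<^sup>2))"
      by (rule order_trans[OF sum_abs sum_mono]) (rule B)
    with A have "\<bar>weak_op a b (\<phi> n) x\<bar> \<le> 4 * (N * (D / (norm x)\<^sup>2))"
      unfolding expand by simp
    with True show ?thesis by (simp add: mult.assoc)
  qed
  note w = dominating_function[OF R, of "4 * N * D"]
  note m = weak_op_measurable[OF a b]
  have ae_lim: "AE x in lborel. (\<lambda>n. weak_op a b (\<phi> n) x) \<longlonglongrightarrow> weak_op a b \<psi> x"
    using AE_nonzero lim by (auto elim: AE_mp)
  have ae_dom: "AE x in lborel. norm (weak_op a b (\<phi> n) x) \<le> indicator (ball 0 (R + 1)) x * (1 / (norm x)\<^sup>2) * (4 * N * D)" for n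
    using AE_nonzero dom by (auto elim: AE_mp)
  have "integrable lborel (weak_op a b \<psi>)"
    by (rule integrable_dominated_convergence[OF m[OF \<psi>(1)] m[OF \<phi>(1)] w ae_lim ae_dom])
  moreover have "(\<lambda>n. integral\<^sup>L lborel (weak_op a b (\<phi> n))) \<longlonglongrightarrow> integral\<^sup>L lborel (weak_op a b \<psi>)"
    by (rule integral_dominated_convergence[OF m[OF \<psi>(1)] m[OF \<phi>(1)] w ae_lim ae_dom])
  then have "integral\<^sup>L lborel (weak_op a b \<psi>) = 0"
    unfolding int0 by (simp add: LIMSEQ_const_iff)
  ultimately show ?thesis by (simp add: has_bochner_integral_iff)
qed

lemma C1_vanishing_bound:
  assumes "Ck_on 2 \<psi> UNIV" "\<psi> 0 = 0" "\<And>j x. \<bar>pd j \<psi> x\<bar> \<le> M"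
  shows "\<bar>\<psi> x\<bar> \<le> 3 * M * norm x"
proof -
  have "((\<lambda>s. \<psi> (s *\<^sub>R x)) has_real_derivative (\<Sum>j\<in>UNIV. x $ j * pd j \<psi> (s *\<^sub>R x))) (at s)" for s
  proof -
    have "((\<lambda>s. s *\<^sub>R x) has_vector_derivative x) (at s)"
      by (auto intro!: derivative_eq_intros)
    from has_vector_derivative_pd_chain[OF C2_D(1)[OF assms(1)] this] show ?thesis
      by (simp add: has_real_derivative_iff_has_vector_derivative)
  qed
  then obtain s where "\<psi> (1 *\<^sub>R x) - \<psi> (0 *\<^sub>R x) = (1 - 0) * (\<Sum>j\<in>UNIV. x $ j * pd j \<psi> (s *\<^sub>R x))"
    using MVT2[of 0 1 "\<lambda>s. \<psi> (s *\<^sub>R x)" "\<lambda>s. \<Sum>j\<in>UNIV. x $ j * pd j \<psi> (s *\<^sub>R x)"] by auto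
  then have "\<bar>\<psi> x\<bar> = \<bar>\<Sum>j\<in>UNIV. x $ j * pd j \<psi> (s *\<^sub>R x)\<bar>" using assms(2) by simp
  also have "\<dots> \<le> (\<Sum>j\<in>(UNIV :: 3 set). norm x * M)"
    by (rule order_trans[OF sum_abs sum_mono])
      (unfold abs_mult, intro mult_mono assms(3) component_le_norm_cart abs_ge_zero norm_ge_zero)
  finally show ?thesis by (simp add: algebra_simps)
qed

text \<open>Subtracting \<open>\<psi> 0\<close> times a fixed cut-off function reduces the claim to test functions vanishing at
  the origin.  These are \<open>O(\<bar>x\<bar>)\<close> and hence covered by \<open>weak_op_vanishing_limit\<close>.\<close>

lemma weak_op_point_source:
  assumes C: "C \<ge> 0" and a: "continuous_on (- {0}) a" and b: "\<And>j. continuous_on (- {0}) (b j)"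
    and a_le: "\<And>x. x \<noteq> 0 \<Longrightarrow> \<bar>a x\<bar> \<le> C / norm x"
    and b_le: "\<And>j x. x \<noteq> 0 \<Longrightarrow> \<bar>b j x\<bar> \<le> C / (norm x)\<^sup>2"
    and away: "\<And>\<phi> r R. Ck_on 2 \<phi> UNIV \<Longrightarrow> supported_in R \<phi> \<Longrightarrow> r > 0 \<Longrightarrow>
      (\<And>x. norm x < r \<Longrightarrow> \<phi> x = 0) \<Longrightarrow> integral\<^sup>L lborel (weak_op a b \<phi>) = 0"
  obtains m where "\<And>\<psi> R. Ck_on 2 \<psi> UNIV \<Longrightarrow> supported_in R \<psi> \<Longrightarrow>
    has_bochner_integral lborel (weak_op a b \<psi>) (m * \<psi> 0)"
proof -
  have vanishing: "has_bochner_integral lborel (weak_op a b \<psi>) 0"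
    if \<psi>: "Ck_on 2 \<psi> UNIV" "supported_in R \<psi>" "\<psi> 0 = 0" and R: "R > 0" for \<psi> R
  proof -
    obtain M where M: "M \<ge> 0" "\<And>j x. \<bar>pd j \<psi> x\<bar> \<le> M"
      using C2_bounded[OF \<psi>(1,2)] by metis
    have le: "\<bar>\<psi> x\<bar> \<le> 3 * M * norm x" for x by (rule C1_vanishing_bound[OF \<psi>(1,3) M(2)])
    define D where "D = C * (R + 1 + 3 * M)"
    show ?thesis
    proof (rule weak_op_vanishing_limit[OF R _ a b \<psi>(1,2)])
      show "D \<ge> 0" using C R M by (simp add: D_def)
      fix x :: "real^3" assume x: "x \<noteq> 0" "norm x \<le> R"
      then have n: "norm x > 0" by simp
      have p: "\<bar>\<psi> x\<bar> / norm x \<le> 3 * M" using le[of x] n by (simp add: pos_divide_le_eq)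
      have "1 + 1 / norm x + \<bar>\<psi> x\<bar> / (norm x)\<^sup>2 = (norm x + 1 + \<bar>\<psi> x\<bar> / norm x) / norm x"
        using n by (simp add: field_simps power2_eq_square)
      also have "\<dots> \<le> (R + 1 + 3 * M) / norm x"
        using p x n by (intro divide_right_mono add_mono) auto
      finally have "\<bar>a x\<bar> * (1 + 1 / norm x + \<bar>\<psi> x\<bar> / (norm x)\<^sup>2) \<le> (C / norm x) * ((R + 1 + 3 * M) / norm x)"
        using C n by (intro mult_mono a_le x) auto
      then show "\<bar>a x\<bar> * (1 + 1 / norm x + \<bar>\<psi> x\<bar> / (norm x)\<^sup>2) \<le> D / (norm x)\<^sup>2"
        by (simp add: D_def power2_eq_square)
      have "\<bar>b j x\<bar> * (1 + \<bar>\<psi> x\<bar> / norm x) \<le> (C / (norm x)\<^sup>2) * (R + 1 + 3 * M)" for j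
        using C n p R by (intro mult_mono b_le x) auto
      then show "\<bar>b j x\<bar> * (1 + \<bar>\<psi> x\<bar> / norm x) \<le> D / (norm x)\<^sup>2" for j
        by (simp add: D_def)
    qed (use away in blast)
  qed
  have integrable: "integrable lborel (weak_op a b \<psi>)"
    if \<psi>: "Ck_on 2 \<psi> UNIV" "supported_in R \<psi>" and R: "R > 0" for \<psi> R
  proof -
    obtain M where M: "M \<ge> 0" "\<And>j x. \<bar>pd j \<psi> x\<bar> \<le> M" "\<And>x. \<bar>laplacian \<psi> x\<bar> \<le> M"
      using C2_bounded[OF \<psi>] by metis
    have le: "norm (weak_op a b \<psi> x) \<le> indicator (ball 0 (R + 1)) x * (1 / (norm x)\<^sup>2) * (C * M * (R + 3))"
      if x: "x \<noteq> 0" for x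
    proof (cases "norm x \<le> R")
      case False
      then show ?thesis using weak_op_supported[OF \<psi>(2), of x] C M R by simp
    next
      case True
      have n: "norm x > 0" using x by simp
      have "\<bar>a x * laplacian \<psi> x\<bar> \<le> C / norm x * M"
        unfolding abs_mult using C by (intro mult_mono a_le x M) auto
      also have "\<dots> = norm x * (C * M / (norm x)\<^sup>2)" using n by (simp add: power2_eq_square)
      also have "\<dots> \<le> R * (C * M / (norm x)\<^sup>2)"
        by (intro mult_right_mono True) (use C M in simp)
      finally have A: "\<bar>a x * laplacian \<psi> x\<bar> \<le> R * (C * M / (norm x)\<^sup>2)" .
      have "\<bar>\<Sum>j\<in>UNIV. b j x * pd j \<psi> x\<bar> \<le> (\<Sum>j\<in>(UNIV :: 3 set). C / (norm x)\<^sup>2 * M)"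
        by (rule order_trans[OF sum_abs sum_mono])
          (unfold abs_mult, use C in \<open>intro mult_mono b_le x M; simp\<close>)
      then have "\<bar>\<Sum>j\<in>UNIV. b j x * pd j \<psi> x\<bar> \<le> 3 * (C * M / (norm x)\<^sup>2)" by simp
      with A have "\<bar>weak_op a b \<psi> x\<bar> \<le> (R + 3) * (C * M / (norm x)\<^sup>2)"
        using abs_triangle_ineq[of "a x * laplacian \<psi> x" "\<Sum>j\<in>UNIV. b j x * pd j \<psi> x"]
        unfolding weak_op_def distrib_right by linarith
      with True show ?thesis by (simp add: mult.commute mult.left_commute)
    qed
    have "AE x in lborel. norm (weak_op a b \<psi> x)
      \<le> norm (indicator (ball 0 (R + 1)) x * (1 / (norm x)\<^sup>2) * (C * M * (R + 3)))"
    proof (rule AE_mp[OF AE_nonzero], rule AE_I2, rule impI)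
      fix x :: "real^3" assume "x \<noteq> 0"
      from order_trans[OF le[OF this] abs_ge_self]
      show "norm (weak_op a b \<psi> x)
        \<le> norm (indicator (ball 0 (R + 1)) x * (1 / (norm x)\<^sup>2) * (C * M * (R + 3)))"
        by (simp only: real_norm_def)
    qed
    then show ?thesis
      by (rule Bochner_Integration.integrable_bound[OF dominating_function[OF R]
            weak_op_measurable[OF a b \<psi>(1)]])
  qed
  \<comment> \<open>The fixed test function \<open>\<psi>0\<close> with \<open>\<psi>0 0 = 1\<close> that measures the source.\<close>
  obtain g :: "real^3 \<Rightarrow> real" where g: "Ck_on 2 g UNIV" "g 0 = 0" "\<And>x. 2 \<le> norm x \<Longrightarrow> g x = 1"
  proof (rule cutoff_family)
    fix g :: "nat \<Rightarrow> real^3 \<Rightarrow> real"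
    assume g: "\<And>n. Ck_on 2 (g n) UNIV" "\<And>n. \<exists>r>0. \<forall>x. norm x < r \<longrightarrow> g n x = 0"
      "\<And>n x. 2 \<le> norm x \<Longrightarrow> g n x = 1"
    from g(2)[of 0] have "g 0 0 = 0" by auto
    with g show thesis by (intro that[of "g 0"]) auto
  qed
  define \<psi>0 where "\<psi>0 = (\<lambda>x. 1 - g x)"
  have \<psi>0: "Ck_on 2 \<psi>0 UNIV" "supported_in 2 \<psi>0" "\<psi>0 0 = 1"
    using Ck_on_diff[OF open_UNIV Ck_on_const g(1)] g(2,3) by (auto simp: \<psi>0_def supported_in_def)
  show ?thesis
  proof (rule that)
    fix \<psi> R assume \<psi>: "Ck_on 2 \<psi> UNIV" "supported_in R \<psi>"
    define c where "c = \<psi> 0"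
    define \<psi>1 where "\<psi>1 = (\<lambda>x. \<psi> x - c * \<psi>0 x)"
    define S where "S = max R 2"
    have c\<psi>0: "Ck_on 2 (\<lambda>x. c * \<psi>0 x) UNIV"
      using Ck_on_mult[OF open_UNIV Ck_on_const \<psi>0(1)] .
    have "supported_in S \<psi>" "supported_in S \<psi>0"
      using \<psi>(2) \<psi>0(2) supported_in_mono by (auto simp: S_def)
    then have \<psi>1: "Ck_on 2 \<psi>1 UNIV" "supported_in S \<psi>1" "\<psi>1 0 = 0"
      using Ck_on_diff[OF open_UNIV \<psi>(1) c\<psi>0] \<psi>0(3) by (auto simp: \<psi>1_def supported_in_def c_def)
    note pdc = pd_linear[OF bounded_linear_mult_right[of c]]
    have pd1: "pd j \<psi>1 = (\<lambda>x. pd j \<psi> x - c * pd j \<psi>0 x)" for j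
      unfolding \<psi>1_def
      by (rule ext) (simp add: pd_diff pdc C2_D(1)[OF \<psi>(1)] C2_D(1)[OF \<psi>0(1)])
    have pd2: "pd j (pd j \<psi>1) x = pd j (pd j \<psi>) x - c * pd j (pd j \<psi>0) x" for j x
      unfolding pd1 by (simp add: pd_diff pdc C2_D(2)[OF \<psi>(1)] C2_D(2)[OF \<psi>0(1)])
    have "weak_op a b \<psi> x = weak_op a b \<psi>1 x + c * weak_op a b \<psi>0 x" for x
      unfolding weak_op_def laplacian_def pd2 unfolding pd1
      by (simp add: sum_3 algebra_simps)
    then have "weak_op a b \<psi> = (\<lambda>x. weak_op a b \<psi>1 x + c * weak_op a b \<psi>0 x)" by (rule ext)
    moreover have "has_bochner_integral lborel (weak_op a b \<psi>1) 0"
      by (rule vanishing[OF \<psi>1]) (simp add: S_def)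
    moreover have "has_bochner_integral lborel (weak_op a b \<psi>0) (integral\<^sup>L lborel (weak_op a b \<psi>0))"
      using integrable[OF \<psi>0(1,2)] by (simp add: has_bochner_integral_iff)
    ultimately have "has_bochner_integral lborel (weak_op a b \<psi>) (0 + c * integral\<^sup>L lborel (weak_op a b \<psi>0))"
      by (simp only:) (intro has_bochner_integral_add has_bochner_integral_mult_right)
    then show "has_bochner_integral lborel (weak_op a b \<psi>) (integral\<^sup>L lborel (weak_op a b \<psi>0) * \<psi> 0)"
      by (simp add: c_def mult.commute)
  qed
qed

lemma Ck_on_vanishing_near_0:
  assumes "Ck_on k f (- {0})" "r > 0" "\<And>x. norm x < r \<Longrightarrow> f x = 0"
  shows "Ck_on k f UNIV"
proof -
  have "Ck_on k f (ball 0 r)"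
    by (rule Ck_on_cong[OF open_ball _ Ck_on_const[of k 0]]) (use assms(3) in auto)
  from Ck_on_union_open[OF _ open_ball assms(1) this] have "Ck_on k f (- {0} \<union> ball 0 r)" by auto
  moreover have "- {0} \<union> ball (0 :: real^3) r = UNIV" using assms(2) by auto
  ultimately show ?thesis by simp
qed

lemma integral_divergence_form:
  fixes F :: "3 \<Rightarrow> real^3 \<Rightarrow> real"
  assumes "\<And>j. Ck_on 1 (F j) (- {0})" "r > 0" "\<And>j x. norm x < r \<Longrightarrow> F j x = 0"
    "\<And>j. supported_in R (F j)" "\<And>x. x \<noteq> 0 \<Longrightarrow> f x = (\<Sum>j\<in>UNIV. pd j (F j) x)"
    "f \<in> borel_measurable lborel"
  shows "integral\<^sup>L lborel f = 0"
proof -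
  have "Ck_on 1 (F j) UNIV" for j
    using Ck_on_vanishing_near_0[OF assms(1,2,3)] .
  then have I: "has_bochner_integral lborel (pd j (F j)) 0" for j
    using integral_pd_zero assms(4) by blast
  then have I': "has_bochner_integral lborel (\<lambda>x. \<Sum>j\<in>UNIV. pd j (F j) x) (\<Sum>j\<in>(UNIV :: 3 set). 0)"
    by (intro has_bochner_integral_sum)
  then have "integral\<^sup>L lborel (\<lambda>x. \<Sum>j\<in>UNIV. pd j (F j) x) = 0"
    by (simp add: has_bochner_integral_iff)
  moreover have "AE x in lborel. f x = (\<Sum>j\<in>UNIV. pd j (F j) x)"
    using AE_nonzero assms(5) by (auto elim: AE_mp)
  ultimately show ?thesis
    using integral_cong_AE[OF assms(6) borel_measurable_has_bochner_integral[OF I']] by simp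
qed

section \<open>Homogeneous solutions of the Navier--Stokes equations\<close>

text \<open>The integrand is the divergence of a compactly supported field that is \<open>C\<^sup>1\<close> on the whole space:
  Green's identity for the viscous term and \<open>u \<phi>\<close>, \<open>p \<phi>\<close> for the others.\<close>

lemma momentum_away:
  assumes u: "Ck_on 2 u (- {0})" and p: "Ck_on 1 p (- {0})"
    and ns: "\<And>x. x \<noteq> 0 \<Longrightarrow> - laplacian u x + advection u u x + gradient p x = 0"
    and div: "\<And>x. x \<noteq> 0 \<Longrightarrow> divergence u x = 0"
    and \<phi>: "Ck_on 2 \<phi> UNIV" "supported_in R \<phi>" "r > 0" "\<And>x. norm x < r \<Longrightarrow> \<phi> x = 0"
  shows "integral\<^sup>L lborel (weak_op (\<lambda>x. - (u x $ i))
    (\<lambda>j x. - (u x $ i * u x $ j) - (if j = i then p x else 0)) \<phi>) = 0"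
proof -
  let ?S = "- {0} :: (real^3) set"
  have oS: "open ?S" by auto
  define F where "F = (\<lambda>j x. \<phi> x * pd j u x $ i - u x $ i * pd j \<phi> x
    - (u x $ i * u x $ j) * \<phi> x - (if j = i then p x * \<phi> x else 0))"
  have u1: "Ck_on 1 u ?S" and pu: "Ck_on 1 (pd j u) ?S" for j
    using u Ck_on_SucD[of 1 u ?S] by (simp_all add: numeral_2_eq_2)
  have "Ck_on 2 \<phi> ?S" by (rule Ck_on_subset[OF \<phi>(1)]) simp
  then have \<phi>1: "Ck_on 1 \<phi> ?S" and p\<phi>: "Ck_on 1 (pd j \<phi>) ?S" for j
    using Ck_on_SucD[of 1 \<phi> ?S] by (simp_all add: numeral_2_eq_2)
  have \<phi>0: "pd j \<phi> x = 0" if "norm x < r" for j x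
    using pd_cong[of "ball 0 r" x \<phi> "\<lambda>x. 0" j] \<phi>(4) that by simp
  show ?thesis
  proof (rule integral_divergence_form[where F = F and r = r and R = R])
    show "Ck_on 1 (F j) ?S" for j
    proof -
      have "Ck_on 1 (\<lambda>x. if j = i then p x * \<phi> x else 0) ?S"
        using Ck_on_mult[OF oS p \<phi>1] Ck_on_const[of 1 0] by (cases "j = i") auto
      then show ?thesis
        unfolding F_def by (intro Ck_on_diff Ck_on_mult Ck_on_nth u1 pu \<phi>1 p\<phi> oS)
    qed
    show "F j x = 0" if "norm x < r" for j x
      using \<phi>(4)[OF that] \<phi>0[OF that] by (simp add: F_def)
    show "supported_in R (F j)" for j
      using \<phi>(2) supported_in_pd[OF \<phi>(2)] by (simp add: supported_in_def F_def)
    show "weak_op (\<lambda>x. - (u x $ i)) (\<lambda>j x. - (u x $ i * u x $ j) - (if j = i then p x else 0)) \<phi>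
      \<in> borel_measurable lborel"
    proof (rule weak_op_measurable[OF _ _ \<phi>(1)])
      have c: "continuous_on ?S u" "continuous_on ?S p"
        using Ck_on_continuous[OF u] Ck_on_continuous[OF p] .
      show "continuous_on ?S (\<lambda>x. - (u x $ i))" by (intro continuous_intros c)
      show "continuous_on ?S (\<lambda>x. - (u x $ i * u x $ j) - (if j = i then p x else 0))" for j
        by (cases "j = i") (auto intro!: continuous_intros c)
    qed
    fix x :: "real^3" assume x: "x \<noteq> 0"
    have d: "u differentiable (at x)" "pd j u differentiable (at x)" "p differentiable (at x)"
      "\<phi> differentiable (at x)" "pd j \<phi> differentiable (at x)" for j
      using x u p C2_D[OF \<phi>(1)] by (simp_all add: numeral_2_eq_2)
    note dm = pd_bilinear(2)[OF bounded_bilinear_mult]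
    have pF: "pd j (F j) x = \<phi> x * pd j (pd j u) x $ i - u x $ i * pd j (pd j \<phi>) x
      - (u x $ i * u x $ j) * pd j \<phi> x - (u x $ i * pd j u x $ j + pd j u x $ i * u x $ j) * \<phi> x
      - (if j = i then p x * pd j \<phi> x + pd j p x * \<phi> x else 0)" for j
    proof -
      define q where "q = (\<lambda>x. if j = i then p x * \<phi> x else 0)"
      have q: "q differentiable (at x)"
        "pd j q x = (if j = i then p x * pd j \<phi> x + pd j p x * \<phi> x else 0)"
        unfolding q_def using d dm[of p x \<phi>] by (cases "j = i"; simp add: pd_mult)+
      have "F j = (\<lambda>x. \<phi> x * pd j u x $ i - u x $ i * pd j \<phi> x - (u x $ i * u x $ j) * \<phi> x - q x)"
        by (simp add: F_def q_def)
      then show ?thesis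
        using d q(1) unfolding q(2)[symmetric]
        by (simp add: pd_diff pd_mult pd_nth differentiable_nth dm)
    qed
    have mom: "laplacian u x $ i = advection u u x $ i + pd i p x"
    proof -
      have "(- laplacian u x + advection u u x + gradient p x) $ i = 0" unfolding ns[OF x] by simp
      then show ?thesis by (simp add: gradient_def)
    qed
    have "(\<Sum>j\<in>UNIV. pd j (F j) x) = \<phi> x * laplacian u x $ i - u x $ i * laplacian \<phi> x
      - (\<Sum>j\<in>UNIV. (u x $ i * u x $ j) * pd j \<phi> x) - u x $ i * divergence u x * \<phi> x
      - advection u u x $ i * \<phi> x - (p x * pd i \<phi> x + pd i p x * \<phi> x)"
      unfolding pF
      by (simp add: sum_subtractf sum.distrib laplacian_def divergence_def advection_def
          sum_distrib_left sum_distrib_right algebra_simps)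
    also have "\<dots> = - (u x $ i) * laplacian \<phi> x
      - (\<Sum>j\<in>UNIV. (u x $ i * u x $ j) * pd j \<phi> x) - p x * pd i \<phi> x"
      unfolding mom div[OF x] by (simp add: algebra_simps)
    also have "\<dots> = weak_op (\<lambda>x. - (u x $ i)) (\<lambda>j x. - (u x $ i * u x $ j) - (if j = i then p x else 0)) \<phi> x"
    proof -
      have "(\<Sum>j\<in>UNIV. (if j = i then p x else 0) * pd j \<phi> x) = p x * pd i \<phi> x"
        by (simp add: if_distrib[where f = "\<lambda>c. c * _"] cong: if_cong)
      then show ?thesis
        by (simp add: weak_op_def left_diff_distrib sum_subtractf sum_negf)
    qed
    finally show "weak_op (\<lambda>x. - (u x $ i)) (\<lambda>j x. - (u x $ i * u x $ j) - (if j = i then p x else 0)) \<phi> x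
      = (\<Sum>j\<in>UNIV. pd j (F j) x)" by simp
  qed (rule \<phi>(3))
qed

lemma continuity_away:
  assumes u: "Ck_on 1 u (- {0})" and div: "\<And>x. x \<noteq> 0 \<Longrightarrow> divergence u x = 0"
    and \<phi>: "Ck_on 2 \<phi> UNIV" "supported_in R \<phi>" "r > 0" "\<And>x. norm x < r \<Longrightarrow> \<phi> x = 0"
  shows "integral\<^sup>L lborel (weak_op (\<lambda>x. 0) (\<lambda>j x. u x $ j) \<phi>) = 0"
proof -
  let ?S = "- {0} :: (real^3) set"
  have oS: "open ?S" by auto
  have "Ck_on 2 \<phi> ?S" by (rule Ck_on_subset[OF \<phi>(1)]) simp
  then have \<phi>1: "Ck_on 1 \<phi> ?S"
    using Ck_on_SucD[of 1 \<phi> ?S] by (simp add: numeral_2_eq_2)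
  show ?thesis
  proof (rule integral_divergence_form[where F = "\<lambda>j x. u x $ j * \<phi> x" and r = r and R = R])
    show "Ck_on 1 (\<lambda>x. u x $ j * \<phi> x) ?S" for j by (intro Ck_on_mult Ck_on_nth u \<phi>1 oS)
    show "supported_in R (\<lambda>x. u x $ j * \<phi> x)" for j using \<phi>(2) by (simp add: supported_in_def)
    show "weak_op (\<lambda>x. 0) (\<lambda>j x. u x $ j) \<phi> \<in> borel_measurable lborel"
      by (rule weak_op_measurable[OF _ _ \<phi>(1)]) (auto intro!: continuous_intros Ck_on_continuous[OF u])
    fix x :: "real^3" assume x: "x \<noteq> 0"
    have d: "u differentiable (at x)" "\<phi> differentiable (at x)" using x u C2_D[OF \<phi>(1)] by simp_all
    have "(\<Sum>j\<in>UNIV. pd j (\<lambda>x. u x $ j * \<phi> x) x) = (\<Sum>j\<in>UNIV. u x $ j * pd j \<phi> x) + divergence u x * \<phi> x"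
      by (simp add: pd_mult pd_nth differentiable_nth d sum.distrib divergence_def sum_distrib_right)
    then show "weak_op (\<lambda>x. 0) (\<lambda>j x. u x $ j) \<phi> x = (\<Sum>j\<in>UNIV. pd j (\<lambda>x. u x $ j * \<phi> x) x)"
      by (simp add: weak_op_def div[OF x])
  qed (use \<phi> in auto)
qed

lemma test_function_D:
  assumes "test_function \<psi>"
  obtains R where "R > 0" "Ck_on 2 \<psi> UNIV" "supported_in R \<psi>"
proof -
  obtain R where R: "R > 0" "\<And>x. x \<in> closure {x. \<psi> x \<noteq> 0} \<Longrightarrow> norm x \<le> R"
    using assms bounded_pos compact_imp_bounded unfolding test_function_def by metis
  show ?thesis
  proof (rule that[OF R(1)])
    show "Ck_on 2 \<psi> UNIV" using assms by (simp add: test_function_def smooth_on_def)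
    show "supported_in R \<psi>"
      unfolding supported_in_def using R(2) closure_subset by (metis (mono_tags) mem_Collect_eq not_le subsetD)
  qed
qed

text \<open>The force is read off from the momentum equation by \<open>weak_op_point_source\<close>.  The continuity
  equation has no source: its coefficient \<open>u\<close> is only of size \<open>1 / \<bar>x\<bar>\<close>, so cut-offs are harmless even
  if \<open>\<psi> 0 \<noteq> 0\<close>.\<close>

theorem homogeneous_navier_stokes_point_force:
  assumes u: "Ck_on 2 u (- {0})" and p: "Ck_on 1 p (- {0})"
    and u_hom: "homogeneous (- 1) u" and p_hom: "homogeneous (- 2) p"
    and ns: "\<And>x. x \<noteq> 0 \<Longrightarrow> - laplacian u x + advection u u x + gradient p x = 0"
    and div: "\<And>x. x \<noteq> 0 \<Longrightarrow> divergence u x = 0"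
  obtains b where "weak_navier_stokes_point_force b u p"
proof -
  have cu: "continuous_on (- {0}) u" and cp: "continuous_on (- {0}) p"
    using Ck_on_continuous[OF u] Ck_on_continuous[OF p] .
  obtain Cu where Cu: "Cu \<ge> 0" "\<And>x. x \<noteq> 0 \<Longrightarrow> norm (u x) \<le> Cu * norm x powi - 1"
    using homogeneous_bounded[OF u_hom cu] by blast
  obtain Cp where Cp: "Cp \<ge> 0" "\<And>x. x \<noteq> 0 \<Longrightarrow> norm (p x) \<le> Cp * norm x powi - 2"
    using homogeneous_bounded[OF p_hom cp] by blast
  have u_le: "\<bar>u x $ i\<bar> \<le> Cu / norm x" if "x \<noteq> 0" for x i
    using Cu(2)[OF that] component_le_norm_cart[of "u x" i] by (simp add: divide_inverse)
  have p_le: "\<bar>p x\<bar> \<le> Cp / (norm x)\<^sup>2" if "x \<noteq> 0" for x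
    using Cp(2)[OF that] by (simp add: power_int_minus divide_inverse)
  define B where "B = (\<lambda>i j x. - (u x $ i * u x $ j) - (if j = i then p x else 0))"
  have "\<exists>m. \<forall>\<psi> R. Ck_on 2 \<psi> UNIV \<longrightarrow> supported_in R \<psi> \<longrightarrow>
    has_bochner_integral lborel (weak_op (\<lambda>x. - (u x $ i)) (B i) \<psi>) (m * \<psi> 0)" for i
  proof -
    define C where "C = Cu + Cu * Cu + Cp"
    have C: "C \<ge> 0" "Cu \<le> C" "Cu * Cu + Cp \<le> C" using Cu(1) Cp(1) by (simp_all add: C_def)
    obtain m where "\<And>\<psi> R. Ck_on 2 \<psi> UNIV \<Longrightarrow> supported_in R \<psi> \<Longrightarrow>
      has_bochner_integral lborel (weak_op (\<lambda>x. - (u x $ i)) (B i) \<psi>) (m * \<psi> 0)"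
    proof (rule weak_op_point_source[OF C(1), of "\<lambda>x. - (u x $ i)" "B i"])
      show "continuous_on (- {0}) (\<lambda>x. - (u x $ i))" by (intro continuous_intros cu)
      show "continuous_on (- {0}) (B i j)" for j
        unfolding B_def by (cases "j = i") (auto intro!: continuous_intros cu cp)
      fix x :: "real^3" assume x: "x \<noteq> 0"
      have "\<bar>u x $ i\<bar> \<le> C / norm x"
        using order_trans[OF u_le[OF x] divide_right_mono[OF C(2) norm_ge_zero]] .
      then show "\<bar>- (u x $ i)\<bar> \<le> C / norm x" by simp
      show "\<bar>B i j x\<bar> \<le> C / (norm x)\<^sup>2" for j
      proof -
        have "\<bar>u x $ i * u x $ j\<bar> \<le> (Cu / norm x) * (Cu / norm x)"
          unfolding abs_mult using Cu(1) by (intro mult_mono u_le x) auto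
        moreover have "\<bar>if j = i then p x else 0\<bar> \<le> Cp / (norm x)\<^sup>2"
          using p_le[OF x] Cp(1) by simp
        ultimately have "\<bar>B i j x\<bar> \<le> (Cu / norm x) * (Cu / norm x) + Cp / (norm x)\<^sup>2"
          unfolding B_def by linarith
        also have "\<dots> = (Cu * Cu + Cp) / (norm x)\<^sup>2" by (simp add: power2_eq_square add_divide_distrib)
        also have "\<dots> \<le> C / (norm x)\<^sup>2" by (intro divide_right_mono C) simp
        finally show ?thesis .
      qed
    next
      fix \<phi> :: "real^3 \<Rightarrow> real" and r R
      assume "Ck_on 2 \<phi> UNIV" "supported_in R \<phi>" "r > 0" "\<And>x. norm x < r \<Longrightarrow> \<phi> x = 0"
      from momentum_away[OF u p ns div this]
      show "integral\<^sup>L lborel (weak_op (\<lambda>x. - (u x $ i)) (B i) \<phi>) = 0" by (simp add: B_def)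
    qed (rule that)
    then show ?thesis by blast
  qed
  then obtain m where m: "\<And>i \<psi> R. Ck_on 2 \<psi> UNIV \<Longrightarrow> supported_in R \<psi> \<Longrightarrow>
    has_bochner_integral lborel (weak_op (\<lambda>x. - (u x $ i)) (B i) \<psi>) (m i * \<psi> 0)" by metis
  have continuity: "has_bochner_integral lborel (weak_op (\<lambda>x. 0) (\<lambda>j x. u x $ j) \<psi>) 0"
    if \<psi>: "Ck_on 2 \<psi> UNIV" "supported_in R \<psi>" and R: "R > 0" for \<psi> R
  proof -
    obtain M where M: "M \<ge> 0" "\<And>x. \<bar>\<psi> x\<bar> \<le> M" using C2_bounded[OF \<psi>] by metis
    show ?thesis
    proof (rule weak_op_vanishing_limit[OF R _ _ _ \<psi>])
      show "0 \<le> Cu * (R + M)" using Cu(1) R M(1) by simp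
      fix x :: "real^3" assume x: "x \<noteq> 0" "norm x \<le> R"
      show "\<bar>0\<bar> * (1 + 1 / norm x + \<bar>\<psi> x\<bar> / (norm x)\<^sup>2) \<le> Cu * (R + M) / (norm x)\<^sup>2"
        using Cu(1) R M(1) by simp
      show "\<bar>u x $ j\<bar> * (1 + \<bar>\<psi> x\<bar> / norm x) \<le> Cu * (R + M) / (norm x)\<^sup>2" for j
      proof -
        have "1 + \<bar>\<psi> x\<bar> / norm x = (norm x + \<bar>\<psi> x\<bar>) / norm x" using x by (simp add: add_divide_distrib)
        also have "\<dots> \<le> (R + M) / norm x" using x M by (intro divide_right_mono add_mono) auto
        finally have "\<bar>u x $ j\<bar> * (1 + \<bar>\<psi> x\<bar> / norm x) \<le> (Cu / norm x) * ((R + M) / norm x)"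
          using Cu(1) by (intro mult_mono u_le x) auto
        then show ?thesis by (simp add: power2_eq_square)
      qed
    next
      fix \<phi> :: "real^3 \<Rightarrow> real" and r
      assume "Ck_on 2 \<phi> UNIV" "supported_in R \<phi>" "r > 0" "\<And>x. norm x < r \<Longrightarrow> \<phi> x = 0"
      moreover have "Ck_on 1 u (- {0})" using u Ck_on_SucD[of 1 u "- {0}"] by (simp add: numeral_2_eq_2)
      ultimately show "integral\<^sup>L lborel (weak_op (\<lambda>x. 0) (\<lambda>j x. u x $ j) \<phi>) = 0"
        using continuity_away div by blast
    qed (auto intro!: continuous_intros cu)
  qed
  show ?thesis
  proof (rule that[of "\<chi> i. m i"])
    show "weak_navier_stokes_point_force (\<chi> i. m i) u p"
      unfolding weak_navier_stokes_point_force_def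
    proof (intro allI impI conjI)
      fix \<psi> :: "real^3 \<Rightarrow> real" assume "test_function \<psi>"
      then obtain R where \<psi>: "R > 0" "Ck_on 2 \<psi> UNIV" "supported_in R \<psi>" by (rule test_function_D)
      show "has_bochner_integral lborel (\<lambda>x. \<Sum>j\<in>UNIV. u x $ j * pd j \<psi> x) 0"
        using continuity[OF \<psi>(2,3,1)] by (simp add: weak_op_def[abs_def])
      fix i
      have "(\<Sum>j\<in>UNIV. (if j = i then p x else 0) * pd j \<psi> x) = p x * pd i \<psi> x" for x
        by (simp add: if_distrib[where f = "\<lambda>c. c * _"] cong: if_cong)
      then have "weak_op (\<lambda>x. - (u x $ i)) (B i) \<psi> = (\<lambda>x. - (u x $ i) * laplacian \<psi> x
        - (\<Sum>j\<in>UNIV. u x $ i * u x $ j * pd j \<psi> x) - p x * pd i \<psi> x)"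
        by (simp add: fun_eq_iff weak_op_def B_def left_diff_distrib sum_subtractf sum_negf)
      with m[OF \<psi>(2,3), of i]
      show "has_bochner_integral lborel (\<lambda>x. - (u x $ i) * laplacian \<psi> x
        - (\<Sum>j\<in>UNIV. u x $ i * u x $ j * pd j \<psi> x) - p x * pd i \<psi> x) ((\<chi> i. m i) $ i * \<psi> 0)"
        by simp
    qed
  qed
qed

section \<open>Rigidity\<close>

theorem theorem1p1:
  fixes u B :: "real^3 \<Rightarrow> real^3" and p :: "real^3 \<Rightarrow> real"
  assumes "smooth_on u (- {0})" and "smooth_on B (- {0})" and "smooth_on p (- {0})"
    and "axisymmetric u" and "axisymmetric B"
    and "self_similar u B p"
    and "\<And>x. x \<noteq> 0 \<Longrightarrow> - laplacian u x + advection u u x - advection B B x + gradient p x = 0"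
    and "\<And>x. x \<noteq> 0 \<Longrightarrow> advection u B x = advection B u x"
    and "\<And>x. x \<noteq> 0 \<Longrightarrow> divergence u x = 0"
    and "\<And>x. x \<noteq> 0 \<Longrightarrow> divergence B x = 0"
    and "\<exists>b :: real \<Rightarrow> real. \<forall>\<rho> \<theta> \<phi>. 0 < \<rho> \<longrightarrow> 0 < \<phi> \<longrightarrow> \<phi> < pi \<longrightarrow>
           B (spherical \<rho> \<theta> \<phi>) = (b \<phi> / \<rho>) *\<^sub>R e_theta \<theta>"
  shows "landau_solution u \<and> (\<forall>x. x \<noteq> 0 \<longrightarrow> B x = 0)"
proof -
  have Ck: "Ck_on 2 u (- {0})" "Ck_on 2 B (- {0})" "Ck_on 1 p (- {0})"
    using assms(1-3) unfolding smooth_on_def by blast+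
  have scale: "u (c *\<^sub>R x) = inverse c *\<^sub>R u x" "B (c *\<^sub>R x) = inverse c *\<^sub>R B x"
    "p (c *\<^sub>R x) = inverse (c\<^sup>2) * p x" if "c > 0" "x \<noteq> 0" for c x
  proof -
    have "u x = c *\<^sub>R u (c *\<^sub>R x)" "B x = c *\<^sub>R B (c *\<^sub>R x)" "p x = c\<^sup>2 * p (c *\<^sub>R x)"
      using assms(6) that unfolding self_similar_def by blast+
    then show "u (c *\<^sub>R x) = inverse c *\<^sub>R u x" "B (c *\<^sub>R x) = inverse c *\<^sub>R B x"
      "p (c *\<^sub>R x) = inverse (c\<^sup>2) * p x"
      using that(1) by simp_all
  qed
  have hom: "homogeneous (- 1) u" "homogeneous (- 1) B" "homogeneous (- 2) p"
    by (simp_all add: homogeneous_def scale power_int_minus)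
  obtain \<beta> where \<beta>: "\<And>\<rho> \<theta> \<phi>. 0 < \<rho> \<Longrightarrow> 0 < \<phi> \<Longrightarrow> \<phi> < pi \<Longrightarrow>
    B (spherical \<rho> \<theta> \<phi>) = (\<beta> \<phi> / \<rho>) *\<^sub>R e_theta \<theta>"
    using assms(11) by blast
  have toroidal: "B (cyl 0 z) $ 1 = 0" "B (cyl 0 z) $ 3 = 0" for z
  proof -
    obtain \<rho> \<phi> where "\<rho> > 0" "0 < \<phi>" "\<phi> < pi" "cyl 0 z = spherical \<rho> 0 \<phi>"
      using cyl_spherical by metis
    then show "B (cyl 0 z) $ 1 = 0" "B (cyl 0 z) $ 3 = 0" by (simp_all add: \<beta> e_theta_def)
  qed
  interpret toroidal_mhd u B p
  proof unfold_locales
    show "u (cyl t z) = rotz t (u (cyl 0 z))" "B (cyl t z) = rotz t (B (cyl 0 z))" for t z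
      using axisymmetric_cyl[OF assms(4)] axisymmetric_cyl[OF assms(5)] .
    show "p differentiable (at x)" if "x \<noteq> 0" for x using Ck(3) that by simp
  qed (fact Ck hom toroidal assms(7-9))+
  have B0: "B x = 0" if "x \<noteq> 0" for x by (rule magnetic_field_zero[OF that])
  have "advection B B x = 0" if "x \<noteq> 0" for x
    using B0[OF that] by (simp add: advection_def)
  with assms(7) have "- laplacian u x + advection u u x + gradient p x = 0" if "x \<noteq> 0" for x
    using that by fastforce
  then obtain b where "weak_navier_stokes_point_force b u p"
    using homogeneous_navier_stokes_point_force[OF Ck(1,3) hom(1,3) _ assms(9)] by blast
  then have "landau_pair b u p"
    using assms(1,3) hom(1,3) by (simp add: landau_pair_def)
  with B0 show ?thesis by (auto simp: landau_solution_def)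
qed

end
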